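(* Let $\{C_i\mid i\in\mathbb{Z}_{>0}\}$ be any set of cycle types such that $\Vert C_k\Vert=k$ for every $k$. Then for every cycle type $\lambda$ there exists a polynomial $\tilde T_\lambda$ in the variables $t_{C_1},\dots,t_{C_{\Vert\lambda\Vert}}$ over the field of rational functions $\mathbb{Q}(N)$ such that for every $n$ for which $\lambda$ and $C_1,\dots,C_{\Vert\lambda\Vert}$ are cycle types occurring in $S_n$, and every $\chi\in\mathrm{Irr}(S_n)$, $$\rho_\chi(\lambda)=\tilde T_\lambda\big(\rho_\chi(C_1),\dots,\rho_\chi(C_{\Vert\lambda\Vert})\big)(n),$$ where $n$ is plugged into the variable $N$. Thus the value $\rho_\chi(\lambda)$ can be computed from the number $n$ and the values $\rho_\chi(C_k)$ for $1\le k\le\Vert\lambda\Vert$.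
   Context: $\mathrm{Irr}(S_n)$ is the set of complex irreducible characters of $S_n$. Cycle types are partitions with parts of size $1$ omitted, regarded as conjugacy classes of $S_n$ for all $n$ at least the sum of the parts of size at least $2$. $\chi(\lambda)$ is the value of $\chi$ on the class $\lambda$ and $\rho_\chi(\lambda)=\chi(\lambda)/\chi(1)$. For $\lambda=(\lambda_1^{a_1},\dots,\lambda_r^{a_r})$ ($a_i$ parts of size $\lambda_i$), $\Vert\lambda\Vert=\sum_i a_i(\lambda_i-1)$, which is the minimum number of transpositions whose product has cycle type $\lambda$. *)

theory Defs
  imports
    "HOL-Algebra.Sym_Groups"
    "HOL-Combinatorics.Orbits"
    "HOL-Computational_Algebra.Fraction_Field"
    "HOL-Computational_Algebra.Polynomial"
    "HOL-Library.Multiset"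
    "HOL-Library.Poly_Mapping"
    "Jordan_Normal_Form.VS_Connect"
begin

text \<open>A matrix representation of degree \<open>d\<close> is a homomorphism into \<open>GL\<^sub>d\<close> over the complex
  numbers, realised as the unit group of the library's ring of \<open>d\<close>-by-\<open>d\<close> matrices.\<close>

definition matrix_rep :: "('g, 'b) monoid_scheme \<Rightarrow> nat \<Rightarrow> ('g \<Rightarrow> complex mat) \<Rightarrow> bool" where
  "matrix_rep G d R \<longleftrightarrow> R \<in> hom G (units_of (ring_mat TYPE(complex) d ()))"

definition irreducible_rep :: "('g, 'b) monoid_scheme \<Rightarrow> nat \<Rightarrow> ('g \<Rightarrow> complex mat) \<Rightarrow> bool" where
  "irreducible_rep G d R \<longleftrightarrow>
     matrix_rep G d R \<and> d > 0 \<and>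
     (\<forall>W. VectorSpace.subspace class_ring W (module_vec TYPE(complex) d) \<longrightarrow>
          (\<forall>g\<in>carrier G. \<forall>w\<in>W. R g *\<^sub>v w \<in> W) \<longrightarrow>
          W = {0\<^sub>v d} \<or> W = carrier_vec d)"

definition mat_trace :: "'a::comm_monoid_add mat \<Rightarrow> 'a" where
  "mat_trace A = (\<Sum>i<dim_row A. A $$ (i, i))"

text \<open>Characters are \<open>undefined\<close> outside the carrier, so that equality of characters is equality
  of functions on the group.\<close>

definition Irr :: "('g, 'b) monoid_scheme \<Rightarrow> ('g \<Rightarrow> complex) set" where
  "Irr G = {\<chi>. \<exists>d R. irreducible_rep G d R \<and> \<chi> = (\<lambda>g\<in>carrier G. mat_trace (R g))}"

text \<open>A cycle type is a multiset of parts in which the parts of size 1 are omitted.\<close>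

definition is_cycle_type :: "nat multiset \<Rightarrow> bool" where
  "is_cycle_type L \<longleftrightarrow> (\<forall>p\<in>#L. p \<ge> 2)"

definition ct_norm :: "nat multiset \<Rightarrow> nat" where
  "ct_norm L = (\<Sum>p\<in>#L. p - 1)"

definition occurs_in :: "nat multiset \<Rightarrow> nat \<Rightarrow> bool" where
  "occurs_in L n \<longleftrightarrow> is_cycle_type L \<and> sum_mset L \<le> n"

definition cycle_type :: "(nat \<Rightarrow> nat) \<Rightarrow> nat multiset" where
  "cycle_type g = image_mset card (mset_set (orbit g ` {x. g x \<noteq> x}))"

definition cycle_class :: "nat \<Rightarrow> nat multiset \<Rightarrow> (nat \<Rightarrow> nat) set" where
  "cycle_class n L = {g \<in> carrier (sym_group n). cycle_type g = L}"

text \<open>If \<open>L\<close> occurs in the symmetric group, then \<open>cycle_class n L\<close> is a conjugacy class, on which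
  a character takes exactly one value; \<open>the_elem\<close> selects it.\<close>

definition class_value :: "nat \<Rightarrow> ((nat \<Rightarrow> nat) \<Rightarrow> complex) \<Rightarrow> nat multiset \<Rightarrow> complex" where
  "class_value n \<chi> L = the_elem (\<chi> ` cycle_class n L)"

definition normalized_value :: "nat \<Rightarrow> ((nat \<Rightarrow> nat) \<Rightarrow> complex) \<Rightarrow> nat multiset \<Rightarrow> complex" where
  "normalized_value n \<chi> L = class_value n \<chi> L / \<chi> \<one>\<^bsub>sym_group n\<^esub>"

definition regular_at :: "'a::field poly fract \<Rightarrow> 'a \<Rightarrow> bool" where
  "regular_at f x \<longleftrightarrow> (\<exists>p q. f = Fract p q \<and> poly q x \<noteq> 0)"

text \<open>Meaningful only if \<open>regular_at f x\<close>; independent of the chosen fraction by the lemma below.\<close>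

definition fract_value :: "'a::field poly fract \<Rightarrow> 'a \<Rightarrow> 'a" where
  "fract_value f x = (THE v. \<exists>p q. f = Fract p q \<and> poly q x \<noteq> 0 \<and> v = poly p x / poly q x)"

lemma fract_value_Fract:
  assumes "poly q x \<noteq> 0"
  shows "fract_value (Fract p q) x = poly p x / poly q x"
  unfolding fract_value_def
proof (rule the_equality)
  fix v assume "\<exists>p' q'. Fract p q = Fract p' q' \<and> poly q' x \<noteq> 0 \<and> v = poly p' x / poly q' x"
  then obtain p' q' where eq: "Fract p q = Fract p' q'" and q': "poly q' x \<noteq> 0"
    and v: "v = poly p' x / poly q' x" by blast
  have "q \<noteq> 0" "q' \<noteq> 0" using assms q' by auto
  then have "p * q' = p' * q" using eq by (simp add: eq_fract)
  then have "poly p x * poly q' x = poly p' x * poly q x" by (metis poly_mult)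
  then show "v = poly p x / poly q x" using assms q' unfolding v by (simp add: frac_eq_eq)
qed (use assms in blast)

text \<open>Multivariate polynomials in variables indexed by the natural numbers: finitely supported
  maps from monomials (finitely supported exponent vectors) to coefficients in the field of
  rational functions in one variable \<open>N\<close>.\<close>

type_synonym ratfun_mpoly = "(nat \<Rightarrow>\<^sub>0 nat) \<Rightarrow>\<^sub>0 rat poly fract"

definition mpoly_vars :: "ratfun_mpoly \<Rightarrow> nat set" where
  "mpoly_vars T = (\<Union>m\<in>Poly_Mapping.keys T. Poly_Mapping.keys m)"

definition mpoly_regular_at :: "ratfun_mpoly \<Rightarrow> nat \<Rightarrow> bool" where
  "mpoly_regular_at T n \<longleftrightarrow>
     (\<forall>m\<in>Poly_Mapping.keys T. regular_at (Poly_Mapping.lookup T m) (of_nat n))"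

text \<open>Substitute \<open>n\<close> for \<open>N\<close> in the coefficients, and \<open>t i\<close> for the \<open>i\<close>-th variable; meaningful only
  if \<open>mpoly_regular_at T n\<close>.\<close>

definition mpoly_eval :: "ratfun_mpoly \<Rightarrow> nat \<Rightarrow> (nat \<Rightarrow> complex) \<Rightarrow> complex" where
  "mpoly_eval T n t =
     (\<Sum>m\<in>Poly_Mapping.keys T.
        of_rat (fract_value (Poly_Mapping.lookup T m) (of_nat n)) *
        (\<Prod>i\<in>Poly_Mapping.keys m. t i ^ Poly_Mapping.lookup m i))"

end

theory Submission
  imports Defs "Jordan_Normal_Form.Spectral_Radius"
begin

text \<open>
  By Schur's lemma a central element of the group algebra acts as a scalar in an irreducible
  representation, so multiplication by it becomes multiplication of normalized character values
  (\<open>Irr_central_sum\<close>).  The central elements used here are the sums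
  \<open>\<Sum> (y\<^sub>j y\<^bsub>j-1\<^esub>) \<cdots> (y\<^sub>2 y\<^sub>1) (y\<^sub>1 y\<^sub>0)\<close> over all words \<open>y\<^sub>0, \<dots>, y\<^sub>j\<close> in \<open>{1..n}\<close>, with
  \<open>(y y)\<close> read as the identity.  Applied to a permutation one factor at a time, such a word is a
  walk: each step either merges the cycle of the current point with another cycle, which raises the
  norm of the cycle type by one, or cuts that cycle, which does not raise it.  Counting the choices
  at each step gives a recursion on cycle types alone, \<open>walk_value\<close>, whose coefficients are
  polynomials in \<open>n\<close>.  After the values are scaled by \<open>n (n-1) \<cdots> (n-s+1)\<close>, where \<open>s\<close> is the number
  of moved points, the merging steps have coefficients that are independent of \<open>n\<close>.  This is why no
  denominators involving \<open>N\<close> arise during the elimination: the structure constants of top degree are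
  those of the Farahat--Higman ring.

  The proof is by induction on the norm \<open>k\<close>.  Scaled values of norm less than \<open>k\<close> are polynomials in the
  values at \<open>C\<^sub>1, \<dots>, C\<^bsub>k-1\<^esub>\<close>, and so are products of them.  Modulo such polynomials,
  multiplying the class \<open>\<mu>\<close> by the walks of \<open>m\<close> steps, where \<open>m\<close> and the norm of \<open>\<mu>\<close> are positive
  and have sum \<open>k\<close>, yields a linear relation between scaled values of norm \<open>k\<close>: the class
  \<open>\<mu> \<union> {m + 1}\<close> appears once, and all others have fewer parts.  Solving these relations by induction
  on the number of parts shows that, modulo the same polynomials, the scaled value at any class of
  norm \<open>k\<close> is an explicit nonzero rational multiple of the one at the \<open>(k+1)\<close>-cycle (\<open>defect_expressible\<close>,
  \<open>indecomposable_coeff_nonzero\<close>).  Hence \<open>C\<^sub>k\<close> can take the place of the \<open>(k+1)\<close>-cycle, whatever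
  its shape.  Undoing the scaling divides by \<open>n (n-1) \<cdots> (n-s+1)\<close>, which is nonzero exactly when the
  cycle type fits into \<open>n\<close> points.
\<close>

section \<open>Central elements in irreducible representations\<close>

lemma matrix_repD:
  assumes "matrix_rep G d R"
  shows matrix_rep_carrier: "g \<in> carrier G \<Longrightarrow> R g \<in> carrier_mat d d"
    and matrix_rep_mult: "g \<in> carrier G \<Longrightarrow> h \<in> carrier G \<Longrightarrow> R (g \<otimes>\<^bsub>G\<^esub> h) = R g * R h"
proof -
  have hom: "R \<in> hom G (units_of (ring_mat TYPE(complex) d ()))"
    using assms by (simp add: matrix_rep_def)
  show "R g \<in> carrier_mat d d" if "g \<in> carrier G"
    using hom_in_carrier[OF hom that] by (auto simp: units_of_def Units_def ring_mat_def)
  show "R (g \<otimes>\<^bsub>G\<^esub> h) = R g * R h" if "g \<in> carrier G" "h \<in> carrier G"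
    using hom_mult[OF hom that] by (simp add: units_of_def ring_mat_def)
qed

lemma matrix_rep_one:
  assumes "matrix_rep G d R" and "group G"
  shows "R \<one>\<^bsub>G\<^esub> = 1\<^sub>m d"
proof -
  interpret M: ring "ring_mat TYPE(complex) d ()" by (rule ring_mat)
  have "group (units_of (ring_mat TYPE(complex) d ()))" by (rule M.units_group)
  then have "R \<one>\<^bsub>G\<^esub> = \<one>\<^bsub>units_of (ring_mat TYPE(complex) d ())\<^esub>"
    using assms hom_one[of R G] by (simp add: matrix_rep_def)
  then show ?thesis by (simp add: units_of_def ring_mat_def)
qed

lemma mat_trace_mult_commute:
  fixes A B :: "'a::comm_semiring_0 mat"
  assumes "A \<in> carrier_mat d d" "B \<in> carrier_mat d d"
  shows "mat_trace (A * B) = mat_trace (B * A)"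
proof -
  have eq: "mat_trace (A * B) = (\<Sum>i<d. \<Sum>j<d. A $$ (i, j) * B $$ (j, i))"
    if "A \<in> carrier_mat d d" "B \<in> carrier_mat d d" for A B :: "'a mat"
    using that by (simp add: mat_trace_def scalar_prod_def atLeast0LessThan)
  show ?thesis
    unfolding eq[OF assms] eq[OF assms(2,1)] by (subst sum.swap) (simp add: mult.commute)
qed

lemma mat_trace_smult:
  fixes A :: "'a::semiring_0 mat"
  assumes "A \<in> carrier_mat d d"
  shows "mat_trace (c \<cdot>\<^sub>m A) = c * mat_trace A"
  using assms by (simp add: mat_trace_def sum_distrib_left)

text \<open>Schur's lemma: over the complex numbers \<open>Z\<close> has an eigenvector, and the eigenspace is invariant
  because \<open>Z\<close> commutes with the representation, so it is everything.\<close>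

lemma irreducible_rep_commutant_scalar:
  assumes irr: "irreducible_rep G d R"
    and Z: "Z \<in> carrier_mat d d"
    and comm: "\<And>g. g \<in> carrier G \<Longrightarrow> R g * Z = Z * R g"
  shows "\<exists>z. Z = z \<cdot>\<^sub>m 1\<^sub>m d"
proof -
  have rep: "matrix_rep G d R" and d: "d > 0" using irr by (auto simp: irreducible_rep_def)
  note Rc = matrix_rep_carrier[OF rep]
  obtain z where "eigenvalue Z z"
    using spectrum_non_empty[OF Z d] by (auto simp: spectrum_def)
  then obtain v where v: "v \<in> carrier_vec d" "v \<noteq> 0\<^sub>v d" "Z *\<^sub>v v = z \<cdot>\<^sub>v v"
    using Z by (auto simp: eigenvalue_def eigenvector_def)
  define W where "W = {w \<in> carrier_vec d. Z *\<^sub>v w = z \<cdot>\<^sub>v w}"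
  have "VectorSpace.subspace class_ring W (module_vec TYPE(complex) d)"
  proof (intro subspace.intro submodule.intro)
    show "vectorspace class_ring (module_vec TYPE(complex) d)" by (rule vec_vs)
    show "Module.module class_ring (module_vec TYPE(complex) d)" by (rule vec_module)
    fix v w :: "complex vec" and c :: complex
    show "W \<subseteq> carrier (module_vec TYPE(complex) d)" by (auto simp: W_def module_vec_simps)
    show "\<zero>\<^bsub>module_vec TYPE(complex) d\<^esub> \<in> W"
    proof -
      have "Z *\<^sub>v 0\<^sub>v d = z \<cdot>\<^sub>v 0\<^sub>v d"
        using Z by (intro eq_vecI) auto
      then show ?thesis by (simp add: W_def module_vec_simps)
    qed
    show "v \<oplus>\<^bsub>module_vec TYPE(complex) d\<^esub> w \<in> W" if "v \<in> W" "w \<in> W"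
    proof -
      have vw: "v \<in> carrier_vec d" "w \<in> carrier_vec d" "Z *\<^sub>v v = z \<cdot>\<^sub>v v" "Z *\<^sub>v w = z \<cdot>\<^sub>v w"
        using that by (auto simp: W_def)
      have "Z *\<^sub>v (v + w) = z \<cdot>\<^sub>v (v + w)"
        using mult_add_distrib_mat_vec[OF Z vw(1,2)] smult_add_distrib_vec[OF vw(1,2), of z] vw(3,4)
        by simp
      then show ?thesis using vw(1,2) by (simp add: W_def module_vec_simps)
    qed
    show "c \<odot>\<^bsub>module_vec TYPE(complex) d\<^esub> v \<in> W" if "v \<in> W"
    proof -
      have v: "v \<in> carrier_vec d" "Z *\<^sub>v v = z \<cdot>\<^sub>v v" using that by (auto simp: W_def)
      have "Z *\<^sub>v (c \<cdot>\<^sub>v v) = z \<cdot>\<^sub>v (c \<cdot>\<^sub>v v)"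
        unfolding mult_mat_vec[OF Z v(1)] v(2) smult_smult_assoc by (simp only: mult.commute)
      then show ?thesis using v(1) by (simp add: W_def module_vec_simps)
    qed
  qed
  moreover have "R g *\<^sub>v w \<in> W" if g: "g \<in> carrier G" and w: "w \<in> W" for g w
  proof -
    have w': "w \<in> carrier_vec d" "Z *\<^sub>v w = z \<cdot>\<^sub>v w" using w by (auto simp: W_def)
    have "Z *\<^sub>v (R g *\<^sub>v w) = (Z * R g) *\<^sub>v w"
      using assoc_mult_mat_vec[OF Z Rc[OF g] w'(1)] by simp
    also have "\<dots> = R g *\<^sub>v (Z *\<^sub>v w)"
      unfolding comm[OF g, symmetric] by (rule assoc_mult_mat_vec[OF Rc[OF g] Z w'(1)])
    also have "\<dots> = z \<cdot>\<^sub>v (R g *\<^sub>v w)"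
      unfolding w'(2) by (rule mult_mat_vec[OF Rc[OF g] w'(1)])
    finally show ?thesis using Rc[OF g] w' by (auto simp: W_def)
  qed
  ultimately have "W = {0\<^sub>v d} \<or> W = carrier_vec d"
    using irr by (auto simp: irreducible_rep_def)
  moreover have "v \<in> W" using v by (simp add: W_def)
  ultimately have all: "W = carrier_vec d" using v(2) by (metis singletonD)
  have "Z = z \<cdot>\<^sub>m 1\<^sub>m d"
  proof (rule eq_matI)
    fix i j assume "i < dim_row (z \<cdot>\<^sub>m 1\<^sub>m d)" "j < dim_col (z \<cdot>\<^sub>m 1\<^sub>m d)"
    then have ij: "i < d" "j < d" by auto
    have "unit_vec d j \<in> W" unfolding all by simp
    then have "Z *\<^sub>v unit_vec d j = z \<cdot>\<^sub>v unit_vec d j" unfolding W_def by simp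
    then have "(Z *\<^sub>v unit_vec d j) $ i = (z \<cdot>\<^sub>v unit_vec d j) $ i" by simp
    then show "Z $$ (i, j) = (z \<cdot>\<^sub>m 1\<^sub>m d) $$ (i, j)"
      using ij Z by auto
  qed (use Z in auto)
  then show ?thesis by (rule exI)
qed

context
  fixes G :: "('g, 'b) monoid_scheme" and \<chi> :: "'g \<Rightarrow> complex"
  assumes G: "group G" and \<chi>: "\<chi> \<in> Irr G"
begin

interpretation group G by (rule G)

lemma Irr_conj:
  assumes "g \<in> carrier G" "p \<in> carrier G"
  shows "\<chi> (p \<otimes>\<^bsub>G\<^esub> g \<otimes>\<^bsub>G\<^esub> inv\<^bsub>G\<^esub> p) = \<chi> g"
proof -
  obtain d R where irr: "irreducible_rep G d R" and \<chi>_eq: "\<chi> = (\<lambda>g\<in>carrier G. mat_trace (R g))"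
    using \<chi> by (auto simp: Irr_def)
  then have rep: "matrix_rep G d R" by (auto simp: irreducible_rep_def)
  have "p \<otimes>\<^bsub>G\<^esub> g \<otimes>\<^bsub>G\<^esub> inv\<^bsub>G\<^esub> p = p \<otimes>\<^bsub>G\<^esub> (g \<otimes>\<^bsub>G\<^esub> inv\<^bsub>G\<^esub> p)" using assms by (simp add: m_assoc)
  then have "\<chi> (p \<otimes>\<^bsub>G\<^esub> g \<otimes>\<^bsub>G\<^esub> inv\<^bsub>G\<^esub> p) = mat_trace (R p * R (g \<otimes>\<^bsub>G\<^esub> inv\<^bsub>G\<^esub> p))"
    using assms by (simp add: \<chi>_eq matrix_rep_mult[OF rep])
  also have "\<dots> = mat_trace (R (g \<otimes>\<^bsub>G\<^esub> inv\<^bsub>G\<^esub> p) * R p)"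
    by (intro mat_trace_mult_commute[of _ d] matrix_rep_carrier[OF rep]) (use assms in auto)
  also have "\<dots> = \<chi> g"
    using assms by (simp add: \<chi>_eq matrix_rep_mult[OF rep, symmetric] m_assoc)
  finally show ?thesis .
qed

lemma Irr_one_nonzero: "\<chi> \<one>\<^bsub>G\<^esub> \<noteq> 0"
proof -
  obtain d R where irr: "irreducible_rep G d R" and \<chi>_eq: "\<chi> = (\<lambda>g\<in>carrier G. mat_trace (R g))"
    using \<chi> by (auto simp: Irr_def)
  have "R \<one>\<^bsub>G\<^esub> = 1\<^sub>m d" using irr G by (intro matrix_rep_one) (auto simp: irreducible_rep_def)
  then have "\<chi> \<one>\<^bsub>G\<^esub> = of_nat d" by (simp add: \<chi>_eq mat_trace_def)
  then show ?thesis using irr by (simp add: irreducible_rep_def)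
qed

text \<open>The family \<open>h\<close> stands for a central element of the group algebra: conjugation only permutes
  the family.  By Schur's lemma this element acts as a scalar, so that taking traces turns
  multiplication by it into multiplication by the sum of its normalized character values.\<close>

lemma Irr_central_sum:
  assumes h: "\<And>i. i \<in> I \<Longrightarrow> h i \<in> carrier G"
    and conj: "\<And>p. p \<in> carrier G \<Longrightarrow>
      \<exists>\<pi>. bij_betw \<pi> I I \<and> (\<forall>i\<in>I. p \<otimes>\<^bsub>G\<^esub> h i = h (\<pi> i) \<otimes>\<^bsub>G\<^esub> p)"
    and g: "g \<in> carrier G"
  shows "\<chi> \<one>\<^bsub>G\<^esub> * (\<Sum>i\<in>I. \<chi> (h i \<otimes>\<^bsub>G\<^esub> g)) = \<chi> g * (\<Sum>i\<in>I. \<chi> (h i))"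
proof -
  obtain d R where irr: "irreducible_rep G d R" and \<chi>_eq: "\<chi> = (\<lambda>g\<in>carrier G. mat_trace (R g))"
    using \<chi> by (auto simp: Irr_def)
  then have rep: "matrix_rep G d R" by (auto simp: irreducible_rep_def)
  note Rc = matrix_rep_carrier[OF rep]
  \<comment> \<open>The sum of the matrices of the family, taken entry by entry.\<close>
  define Z where "Z = mat d d (\<lambda>(a, b). \<Sum>i\<in>I. R (h i) $$ (a, b))"
  have Z: "Z \<in> carrier_mat d d" by (simp add: Z_def)
  have left: "(R p * Z) $$ (a, b) = (\<Sum>i\<in>I. R (p \<otimes>\<^bsub>G\<^esub> h i) $$ (a, b))"
    if "p \<in> carrier G" "a < d" "b < d" for p a b
  proof -
    have "(R p * Z) $$ (a, b) = (\<Sum>k<d. R p $$ (a, k) * (\<Sum>i\<in>I. R (h i) $$ (k, b)))"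
      using Rc[OF that(1)] that by (simp add: Z_def scalar_prod_def atLeast0LessThan)
    also have "\<dots> = (\<Sum>i\<in>I. \<Sum>k<d. R p $$ (a, k) * R (h i) $$ (k, b))"
      unfolding sum_distrib_left by (rule sum.swap)
    also have "\<dots> = (\<Sum>i\<in>I. R (p \<otimes>\<^bsub>G\<^esub> h i) $$ (a, b))"
      by (rule sum.cong) (use that h Rc in
        \<open>auto simp: matrix_rep_mult[OF rep] scalar_prod_def atLeast0LessThan carrier_matD[OF Rc]\<close>)
    finally show ?thesis .
  qed
  have right: "(Z * R p) $$ (a, b) = (\<Sum>i\<in>I. R (h i \<otimes>\<^bsub>G\<^esub> p) $$ (a, b))"
    if "p \<in> carrier G" "a < d" "b < d" for p a b
  proof -
    have "(Z * R p) $$ (a, b) = (\<Sum>k<d. (\<Sum>i\<in>I. R (h i) $$ (a, k)) * R p $$ (k, b))"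
      using Rc[OF that(1)] that by (simp add: Z_def scalar_prod_def atLeast0LessThan)
    also have "\<dots> = (\<Sum>i\<in>I. \<Sum>k<d. R (h i) $$ (a, k) * R p $$ (k, b))"
      unfolding sum_distrib_right by (rule sum.swap)
    also have "\<dots> = (\<Sum>i\<in>I. R (h i \<otimes>\<^bsub>G\<^esub> p) $$ (a, b))"
      by (rule sum.cong) (use that h Rc in
        \<open>auto simp: matrix_rep_mult[OF rep] scalar_prod_def atLeast0LessThan carrier_matD[OF Rc]\<close>)
    finally show ?thesis .
  qed
  have comm: "R p * Z = Z * R p" if p: "p \<in> carrier G" for p
  proof (rule eq_matI)
    fix a b assume "a < dim_row (Z * R p)" "b < dim_col (Z * R p)"
    then have ab: "a < d" "b < d" using Z Rc[OF p] by auto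
    obtain \<pi> where \<pi>: "bij_betw \<pi> I I" "\<forall>i\<in>I. p \<otimes>\<^bsub>G\<^esub> h i = h (\<pi> i) \<otimes>\<^bsub>G\<^esub> p"
      using conj[OF p] by blast
    have "(R p * Z) $$ (a, b) = (\<Sum>i\<in>I. R (h (\<pi> i) \<otimes>\<^bsub>G\<^esub> p) $$ (a, b))"
      unfolding left[OF p ab] by (rule sum.cong) (use \<pi> in auto)
    also have "\<dots> = (Z * R p) $$ (a, b)"
      unfolding right[OF p ab]
      using sum.reindex_bij_betw[OF \<pi>(1), of "\<lambda>i. R (h i \<otimes>\<^bsub>G\<^esub> p) $$ (a, b)"] by simp
    finally show "(R p * Z) $$ (a, b) = (Z * R p) $$ (a, b)" .
  qed (use Z Rc[OF p] in auto)
  obtain z where z: "Z = z \<cdot>\<^sub>m 1\<^sub>m d"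
    using irreducible_rep_commutant_scalar[OF irr Z comm] by auto
  have trace: "(\<Sum>i\<in>I. \<chi> (h i \<otimes>\<^bsub>G\<^esub> p)) = z * \<chi> p" if p: "p \<in> carrier G" for p
  proof -
    have "(\<Sum>i\<in>I. \<chi> (h i \<otimes>\<^bsub>G\<^esub> p)) = (\<Sum>i\<in>I. \<Sum>a<d. R (h i \<otimes>\<^bsub>G\<^esub> p) $$ (a, a))"
      by (rule sum.cong) (use p h in \<open>auto simp: \<chi>_eq mat_trace_def carrier_matD[OF Rc]\<close>)
    also have "\<dots> = (\<Sum>a<d. \<Sum>i\<in>I. R (h i \<otimes>\<^bsub>G\<^esub> p) $$ (a, a))"
      by (rule sum.swap)
    also have "\<dots> = (\<Sum>a<d. (Z * R p) $$ (a, a))"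
      by (intro sum.cong refl right[OF p, symmetric]) auto
    also have "\<dots> = mat_trace (Z * R p)" using Z by (simp add: mat_trace_def)
    also have "Z * R p = z \<cdot>\<^sub>m R p"
      using mult_smult_assoc_mat[of "1\<^sub>m d" d d "R p" d z] Rc[OF p] by (simp add: z)
    finally show ?thesis using p by (simp add: mat_trace_smult[OF Rc] \<chi>_eq)
  qed
  have "(\<Sum>i\<in>I. \<chi> (h i)) = z * \<chi> \<one>\<^bsub>G\<^esub>"
    using trace[of "\<one>\<^bsub>G\<^esub>"] h by simp
  then show ?thesis unfolding trace[OF g] by (simp only: mult.assoc mult.commute mult.left_commute)
qed

end

section \<open>Polynomials over the rational functions, as functions\<close>

abbreviation rat_poly_at :: "rat poly \<Rightarrow> nat \<Rightarrow> complex" where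
  "rat_poly_at p n \<equiv> of_rat (poly p (of_nat n))"

abbreviation monom_value :: "(nat \<Rightarrow>\<^sub>0 nat) \<Rightarrow> (nat \<Rightarrow> complex) \<Rightarrow> complex" where
  "monom_value m t \<equiv> \<Prod>i\<in>Poly_Mapping.keys m. t i ^ Poly_Mapping.lookup m i"

text \<open>Polynomials in \<open>t\<^sub>1, \<dots>, t\<^sub>k\<close> with coefficients in \<open>\<rat>[N]\<close>, as functions of \<open>n\<close> and \<open>t\<close>.
  Generating them by monomials and sums makes the passage to \<open>ratfun_mpoly\<close> additive, so that
  products of finitely supported maps never have to be evaluated.\<close>

inductive_set poly_fun :: "nat \<Rightarrow> (nat \<Rightarrow> (nat \<Rightarrow> complex) \<Rightarrow> complex) set" for k where
  monom: "Poly_Mapping.keys m \<subseteq> {1..k} \<Longrightarrow>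
    (\<lambda>n t. rat_poly_at p n * monom_value m t) \<in> poly_fun k"
| add: "f \<in> poly_fun k \<Longrightarrow> g \<in> poly_fun k \<Longrightarrow> (\<lambda>n t. f n t + g n t) \<in> poly_fun k"

lemma poly_fun_mono: "f \<in> poly_fun k \<Longrightarrow> k \<le> l \<Longrightarrow> f \<in> poly_fun l"
proof (induction rule: poly_fun.induct)
  case (monom m p)
  then have "Poly_Mapping.keys m \<subseteq> {1..l}" by fastforce
  then show ?case by (rule poly_fun.monom)
qed (auto intro: poly_fun.add)

lemma poly_fun_const: "(\<lambda>n t. rat_poly_at p n) \<in> poly_fun k"
  using poly_fun.monom[of 0 k p] by simp

lemma poly_fun_var: "1 \<le> i \<Longrightarrow> i \<le> k \<Longrightarrow> (\<lambda>n t. t i) \<in> poly_fun k"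
  using poly_fun.monom[of "Poly_Mapping.single i 1" k 1] by simp

lemma monom_value_add: "monom_value (m + m') t = monom_value m t * monom_value m' t"
proof -
  let ?S = "Poly_Mapping.keys m \<union> Poly_Mapping.keys m'"
  have ext: "monom_value x t = (\<Prod>i\<in>?S. t i ^ Poly_Mapping.lookup x i)"
    if "Poly_Mapping.keys x \<subseteq> ?S" for x
    by (rule prod.mono_neutral_left) (use that in \<open>auto simp: in_keys_iff\<close>)
  show ?thesis
    using ext[of m] ext[of m'] ext[of "m + m'"] keys_add[of m m']
    by (simp add: lookup_add power_add prod.distrib)
qed

lemma poly_fun_mult:
  assumes "f \<in> poly_fun k" "g \<in> poly_fun k"
  shows "(\<lambda>n t. f n t * g n t) \<in> poly_fun k"
  using assms(1)
proof (induction rule: poly_fun.induct)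
  case (monom m p)
  note m = monom
  show ?case
    using assms(2)
  proof (induction rule: poly_fun.induct)
    case (monom m' p')
    have "Poly_Mapping.keys (m + m') \<subseteq> {1..k}" using keys_add[of m m'] m monom by blast
    from poly_fun.monom[OF this, of "p * p'"] show ?case
      by (simp add: monom_value_add of_rat_mult mult_ac)
  next
    case (add f g)
    show ?case using poly_fun.add[OF add.IH] by (simp add: distrib_left)
  qed
next
  case (add f g)
  show ?case using poly_fun.add[OF add.IH] by (simp add: distrib_right)
qed

lemma regular_fract_value_add:
  assumes "regular_at f x" "regular_at g x"
  shows "regular_at (f + g) x \<and> fract_value (f + g) x = fract_value f x + fract_value g x"
proof -
  obtain p q p' q' where f: "f = Fract p q" "poly q x \<noteq> 0" and g: "g = Fract p' q'" "poly q' x \<noteq> 0"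
    using assms by (auto simp: regular_at_def)
  have "q \<noteq> 0" "q' \<noteq> 0" using f g by auto
  then have "f + g = Fract (p * q' + p' * q) (q * q')" using f g by simp
  moreover have "poly (q * q') x \<noteq> 0" using f g by simp
  ultimately have "regular_at (f + g) x"
    and "fract_value (f + g) x = poly (p * q' + p' * q) x / poly (q * q') x"
    using fract_value_Fract[of "q * q'" x "p * q' + p' * q"] unfolding regular_at_def
    by (blast, metis)
  then show ?thesis using f g by (simp add: fract_value_Fract add_frac_eq)
qed

lemma regular_at_zero: "regular_at 0 x" and fract_value_zero: "fract_value 0 x = 0"
proof -
  have zero: "(0 :: 'a poly fract) = Fract 0 1" by (simp add: Zero_fract_def)
  show "regular_at 0 x" unfolding regular_at_def zero by (rule exI[of _ 0], rule exI[of _ 1]) simp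
  show "fract_value 0 x = 0" unfolding zero by (subst fract_value_Fract) auto
qed

lemma mpoly_regular_eval_add:
  assumes "mpoly_regular_at T n" "mpoly_regular_at T' n"
  shows "mpoly_regular_at (T + T') n"
    and "mpoly_eval (T + T') n t = mpoly_eval T n t + mpoly_eval T' n t"
proof -
  have reg: "regular_at (Poly_Mapping.lookup S m) (of_nat n)" if "mpoly_regular_at S n" for S m
    using that by (cases "m \<in> Poly_Mapping.keys S") (auto simp: mpoly_regular_at_def in_keys_iff regular_at_zero)
  note sum_reg = regular_fract_value_add[OF reg[OF assms(1)] reg[OF assms(2)]]
  show "mpoly_regular_at (T + T') n"
    using sum_reg by (auto simp: mpoly_regular_at_def lookup_add)
  let ?S = "Poly_Mapping.keys T \<union> Poly_Mapping.keys T'"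
  have ext: "mpoly_eval X n t =
      (\<Sum>m\<in>?S. of_rat (fract_value (Poly_Mapping.lookup X m) (of_nat n)) * monom_value m t)"
    if "Poly_Mapping.keys X \<subseteq> ?S" for X
    unfolding mpoly_eval_def
    by (rule sum.mono_neutral_left) (use that in \<open>auto simp: in_keys_iff fract_value_zero\<close>)
  show "mpoly_eval (T + T') n t = mpoly_eval T n t + mpoly_eval T' n t"
    using ext[of T] ext[of T'] ext[of "T + T'"] keys_add[of T T'] sum_reg
    by (simp add: lookup_add of_rat_add distrib_right sum.distrib)
qed

text \<open>The denominator \<open>q\<close> is kept explicit because it decides at which \<open>n\<close> the coefficients may be
  evaluated.\<close>

lemma poly_fun_divide_imp_mpoly:
  assumes "f \<in> poly_fun k" and "q \<noteq> 0"
  shows "\<exists>T. mpoly_vars T \<subseteq> {1..k} \<and>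
    (\<forall>n t. poly q (of_nat n) \<noteq> 0 \<longrightarrow> mpoly_regular_at T n \<and> mpoly_eval T n t = f n t / rat_poly_at q n)"
  using assms(1)
proof (induction rule: poly_fun.induct)
  case (monom m p)
  let ?T = "Poly_Mapping.single m (Fract p q)"
  have sub: "Poly_Mapping.keys ?T \<subseteq> {m}" by simp
  then have "mpoly_vars ?T \<subseteq> {1..k}" using monom by (auto simp: mpoly_vars_def split: if_splits)
  moreover have "mpoly_regular_at ?T n \<and>
      mpoly_eval ?T n t = rat_poly_at p n * monom_value m t / rat_poly_at q n"
    if q: "poly q (of_nat n) \<noteq> 0" for n t
  proof
    show "mpoly_regular_at ?T n" using q by (auto simp: mpoly_regular_at_def regular_at_def)
    have "mpoly_eval ?T n t = of_rat (fract_value (Fract p q) (of_nat n)) * monom_value m t"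
      using fract_value_zero[of "of_nat n :: rat"]
      by (cases "Fract p q = 0") (simp_all add: mpoly_eval_def)
    then show "mpoly_eval ?T n t = rat_poly_at p n * monom_value m t / rat_poly_at q n"
      using q by (simp add: fract_value_Fract of_rat_divide)
  qed
  ultimately show ?case by blast
next
  case (add f g)
  then obtain T T' where T: "mpoly_vars T \<subseteq> {1..k}" "\<And>n t. poly q (of_nat n) \<noteq> 0 \<Longrightarrow>
      mpoly_regular_at T n \<and> mpoly_eval T n t = f n t / rat_poly_at q n"
    and T': "mpoly_vars T' \<subseteq> {1..k}" "\<And>n t. poly q (of_nat n) \<noteq> 0 \<Longrightarrow>
      mpoly_regular_at T' n \<and> mpoly_eval T' n t = g n t / rat_poly_at q n"
    by blast
  have "mpoly_vars (T + T') \<subseteq> {1..k}"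
    using T(1) T'(1) keys_add[of T T'] by (fastforce simp: mpoly_vars_def)
  moreover have "mpoly_regular_at (T + T') n \<and>
      mpoly_eval (T + T') n t = (f n t + g n t) / rat_poly_at q n"
    if "poly q (of_nat n) \<noteq> 0" for n t
    using T(2)[OF that] T'(2)[OF that] mpoly_regular_eval_add[of T n T']
    by (simp add: add_divide_distrib)
  ultimately show ?case by blast
qed

section \<open>Walks on cycle types\<close>

text \<open>The contribution of a cycle through \<open>c\<close> points to a cycle type.  Allowing \<open>c = 0\<close> and \<open>c = 1\<close>
  treats fixed points and empty pieces like all other cycles.\<close>

definition cycle_part :: "nat \<Rightarrow> nat multiset" where
  "cycle_part c = (if c \<ge> 2 then {#c#} else {#})"

lemma is_cycle_type_simps [simp]:
  "is_cycle_type {#}"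
  "is_cycle_type (M + N) \<longleftrightarrow> is_cycle_type M \<and> is_cycle_type N"
  "is_cycle_type (add_mset a M) \<longleftrightarrow> a \<ge> 2 \<and> is_cycle_type M"
  "is_cycle_type (cycle_part c)"
  by (auto simp: is_cycle_type_def cycle_part_def)

lemma is_cycle_type_remove: "is_cycle_type M \<Longrightarrow> is_cycle_type (M - {#a#})"
  by (auto simp: is_cycle_type_def dest: in_diffD)

lemma is_cycle_typeD: "is_cycle_type M \<Longrightarrow> a \<in># M \<Longrightarrow> a \<ge> 2"
  by (auto simp: is_cycle_type_def)

lemma ct_norm_simps [simp]:
  "ct_norm {#} = 0"
  "ct_norm (M + N) = ct_norm M + ct_norm N"
  "ct_norm (add_mset a M) = a - 1 + ct_norm M"
  "ct_norm (cycle_part c) = c - 1"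
  by (auto simp: ct_norm_def cycle_part_def)

lemma ct_norm_remove: "a \<in># M \<Longrightarrow> a - 1 + ct_norm (M - {#a#}) = ct_norm M"
  by (metis ct_norm_simps(3) insert_DiffM)

lemma sum_mset_remove: "(a::nat) \<in># M \<Longrightarrow> a + sum_mset (M - {#a#}) = sum_mset M"
  by (simp add: sum_mset.remove)

lemma ct_norm_plus_size: "is_cycle_type M \<Longrightarrow> ct_norm M + size M = sum_mset M"
  by (induction M) auto

lemma ct_norm_pos: "is_cycle_type M \<Longrightarrow> M \<noteq> {#} \<Longrightarrow> ct_norm M \<ge> 1"
  by (cases M) auto

text \<open>The state of a walk is the length \<open>c\<close> of the cycle through the current point and the multiset
  \<open>\<mu>\<close> of the lengths of the other cycles; \<open>r\<close> is summed over the final states.  The three summands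
  of the recursion are the moves to a fixed point, to one of the \<open>a\<close> points of another cycle, and to a
  point of the same cycle, which cuts off a piece of length \<open>i\<close>; staying in place is \<open>i = 0\<close>.\<close>

fun walk_value :: "(nat multiset \<Rightarrow> complex) \<Rightarrow> nat \<Rightarrow> nat \<Rightarrow> nat \<Rightarrow> nat multiset \<Rightarrow> complex" where
  "walk_value r n 0 c \<mu> = r (\<mu> + cycle_part c)"
| "walk_value r n (Suc j) c \<mu> =
     (of_nat n - of_nat (c + sum_mset \<mu>)) * walk_value r n j (c + 1) \<mu>
     + (\<Sum>a\<in>#\<mu>. of_nat a * walk_value r n j (c + a) (\<mu> - {#a#}))
     + (\<Sum>i<c. walk_value r n j (c - i) (\<mu> + cycle_part i))"

text \<open>All that the elimination needs to know about irreducible characters: the class \<open>\<mu>\<close> times the sum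
  over all walks.  On the right a walk begins at a fixed point or on one of the cycles of \<open>\<mu>\<close>.\<close>

definition admissible :: "nat \<Rightarrow> (nat multiset \<Rightarrow> complex) \<Rightarrow> bool" where
  "admissible n r \<longleftrightarrow> r {#} = 1 \<and>
     (\<forall>\<mu> j. is_cycle_type \<mu> \<and> sum_mset \<mu> \<le> n \<longrightarrow>
        r \<mu> * (of_nat n * walk_value r n j 1 {#}) =
        (of_nat n - of_nat (sum_mset \<mu>)) * walk_value r n j 1 \<mu>
        + (\<Sum>a\<in>#\<mu>. of_nat a * walk_value r n j a (\<mu> - {#a#})))"

definition falling_poly :: "nat \<Rightarrow> rat poly" where
  "falling_poly s = (\<Prod>i<s. [:- of_nat i, 1:])"

lemma falling_poly_0: "rat_poly_at (falling_poly 0) n = 1"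
  by (simp add: falling_poly_def)

lemma rat_poly_at_linear: "rat_poly_at [:- of_nat s, 1:] n = of_nat n - of_nat s"
  by (simp add: of_rat_diff)

lemma falling_poly_Suc:
  "rat_poly_at (falling_poly (Suc s)) n = rat_poly_at (falling_poly s) n * (of_nat n - of_nat s)"
  unfolding falling_poly_def prod.lessThan_Suc poly_mult of_rat_mult rat_poly_at_linear ..

lemma poly_falling_poly_eq_0_iff: "poly (falling_poly s) (of_nat n) = 0 \<longleftrightarrow> n < s"
  by (auto simp: falling_poly_def poly_prod)

text \<open>The factor counts the injective placements of the points moved by \<open>\<mu>\<close> in \<open>{1..n}\<close>.  It vanishes
  if \<open>\<mu>\<close> does not fit, so that the relations below hold for every \<open>n\<close>, also when some of the
  intermediate types do not occur.\<close>

definition scaled_value :: "nat multiset \<Rightarrow> nat \<Rightarrow> (nat multiset \<Rightarrow> complex) \<Rightarrow> complex" where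
  "scaled_value \<mu> n r = rat_poly_at (falling_poly (sum_mset \<mu>)) n * r \<mu>"

definition scaled_walk :: "nat \<Rightarrow> nat \<Rightarrow> nat multiset \<Rightarrow> nat \<Rightarrow> (nat multiset \<Rightarrow> complex) \<Rightarrow> complex" where
  "scaled_walk j c \<mu> n r = rat_poly_at (falling_poly (c + sum_mset \<mu>)) n * walk_value r n j c \<mu>"

text \<open>The number of points in a state, those of \<open>\<mu>\<close> and of the current cycle, drops under a cut only if
  the piece cut off is a single point; the scaling then changes by one linear factor.\<close>

definition split_factor :: "nat \<Rightarrow> nat \<Rightarrow> rat poly" where
  "split_factor s i = (if i = 1 then [:- of_nat (s - 1), 1:] else 1)"

lemma scaled_walk_0:
  "c \<ge> 2 \<Longrightarrow> scaled_walk 0 c \<mu> n r = scaled_value (add_mset c \<mu>) n r"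
  "scaled_walk 0 (Suc 0) \<mu> n r = rat_poly_at [:- of_nat (sum_mset \<mu>), 1:] n * scaled_value \<mu> n r"
  unfolding rat_poly_at_linear
  by (simp_all add: scaled_walk_def scaled_value_def cycle_part_def falling_poly_Suc)

lemma scaled_walk_Suc:
  assumes "c \<ge> 1"
  shows "scaled_walk (Suc j) c \<mu> n r = scaled_walk j (c + 1) \<mu> n r
    + (\<Sum>a\<in>#\<mu>. of_nat a * scaled_walk j (c + a) (\<mu> - {#a#}) n r)
    + (\<Sum>i<c. rat_poly_at (split_factor (c + sum_mset \<mu>) i) n *
          scaled_walk j (c - i) (\<mu> + cycle_part i) n r)"
proof -
  let ?f = "\<lambda>s. rat_poly_at (falling_poly s) n"
  let ?s = "c + sum_mset \<mu>"
  have 1: "?f ?s * ((of_nat n - of_nat ?s) * walk_value r n j (c + 1) \<mu>) = scaled_walk j (c + 1) \<mu> n r"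
    using falling_poly_Suc[of ?s n] by (simp add: scaled_walk_def)
  have 2: "?f ?s * (\<Sum>a\<in>#\<mu>. of_nat a * walk_value r n j (c + a) (\<mu> - {#a#}))
      = (\<Sum>a\<in>#\<mu>. of_nat a * scaled_walk j (c + a) (\<mu> - {#a#}) n r)"
    unfolding sum_mset_distrib_left
    by (rule arg_cong[of _ _ sum_mset], rule image_mset_cong)
       (simp add: scaled_walk_def sum_mset_remove add.assoc)
  have split: "?f ?s = rat_poly_at (split_factor ?s i) n * ?f (c - i + sum_mset (\<mu> + cycle_part i))"
    if "i < c" for i
  proof (cases "i = 1")
    case True
    then have "?s = Suc (c - i + sum_mset (\<mu> + cycle_part i))"
      using that by (simp add: cycle_part_def)
    then show ?thesis using True falling_poly_Suc[of "?s - 1" n]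
      by (simp only: split_factor_def rat_poly_at_linear mult.commute simp_thms if_True diff_Suc_1)
  next
    case False
    then have "?s = c - i + sum_mset (\<mu> + cycle_part i)" using that by (auto simp: cycle_part_def)
    with False show ?thesis by (simp only: split_factor_def if_False poly_1 of_rat_1 mult_1_left)
  qed
  have 3: "?f ?s * (\<Sum>i<c. walk_value r n j (c - i) (\<mu> + cycle_part i))
      = (\<Sum>i<c. rat_poly_at (split_factor ?s i) n * scaled_walk j (c - i) (\<mu> + cycle_part i) n r)"
    unfolding sum_distrib_left
    by (rule sum.cong) (simp_all add: split scaled_walk_def mult.assoc)
  show ?thesis
    unfolding 1[symmetric] 2[symmetric] 3[symmetric] by (simp add: scaled_walk_def distrib_left)
qed

lemma admissible_scaled_walk:
  assumes "admissible n r" and "is_cycle_type \<mu>"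
  shows "scaled_value \<mu> n r * scaled_walk j 1 {#} n r =
    scaled_walk j 1 \<mu> n r + (\<Sum>a\<in>#\<mu>. of_nat a * scaled_walk j a (\<mu> - {#a#}) n r)"
proof -
  let ?f = "rat_poly_at (falling_poly (sum_mset \<mu>)) n"
  have 1: "scaled_walk j 1 \<mu> n r = ?f * ((of_nat n - of_nat (sum_mset \<mu>)) * walk_value r n j 1 \<mu>)"
    by (simp add: scaled_walk_def falling_poly_Suc)
  have 2: "(\<Sum>a\<in>#\<mu>. of_nat a * scaled_walk j a (\<mu> - {#a#}) n r) =
      ?f * (\<Sum>a\<in>#\<mu>. of_nat a * walk_value r n j a (\<mu> - {#a#}))"
    unfolding sum_mset_distrib_left
    by (rule arg_cong[of _ _ sum_mset], rule image_mset_cong) (simp add: scaled_walk_def sum_mset_remove)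
  have 3: "scaled_value \<mu> n r * scaled_walk j 1 {#} n r =
      ?f * (r \<mu> * (of_nat n * walk_value r n j 1 {#}))"
    using falling_poly_Suc[of 0 n] by (simp add: scaled_walk_def scaled_value_def falling_poly_0)
  show ?thesis
  proof (cases "sum_mset \<mu> \<le> n")
    case True
    then show ?thesis
      using assms unfolding 1 2 3 admissible_def by (simp only: distrib_left[symmetric] simp_thms)
  next
    case False
    then have "?f = 0" by (simp add: poly_falling_poly_eq_0_iff)
    then show ?thesis unfolding 1 2 3 by simp
  qed
qed

text \<open>The multiple of the value at the \<open>(k+1)\<close>-cycle, \<open>k + 1 = c + ct_norm \<mu> + j\<close>, to which a walk of
  length \<open>j\<close> from the state \<open>(c, \<mu>)\<close> reduces when cuts are ignored.  It does not depend on \<open>j\<close>: the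
  recursion for merging steps has this closed form as a stationary solution.\<close>

definition merge_coeff :: "nat \<Rightarrow> nat multiset \<Rightarrow> rat" where
  "merge_coeff c \<mu> = (- 1) ^ size \<mu> * of_nat c * of_nat (prod_mset \<mu>) *
     pochhammer (of_nat (c + ct_norm \<mu>)) (size \<mu>) / of_nat (c + ct_norm \<mu>)"

text \<open>Put \<open>x = c + ct_norm \<mu>\<close> and \<open>q = size \<mu>\<close>, which may be taken positive.  Every merge leads to a state with \<open>x + 1\<close> in
  place of \<open>x\<close>, because a merge raises the norm by one.  After division by the common Pochhammer
  factor, the claim becomes \<open>(c + 1) (x + q) - \<Sum> (c + a) = c (x + 1)\<close>, which holds since
  the parts of \<open>\<mu>\<close> add up to \<open>ct_norm \<mu> + q\<close>.  For \<open>c = 0\<close> the left-hand side of the recursion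
  vanishes; this instance cancels the coefficients in the relation given by \<open>admissible\<close>.\<close>

lemma merge_coeff_rec:
  assumes \<mu>: "is_cycle_type \<mu>" and pos: "c + ct_norm \<mu> \<ge> 1"
  shows "merge_coeff c \<mu> = merge_coeff (c + 1) \<mu> +
    (\<Sum>a\<in>#\<mu>. of_nat a * merge_coeff (c + a) (\<mu> - {#a#}))"
proof (cases "\<mu> = {#}")
  case True
  then show ?thesis using pos by (simp add: merge_coeff_def)
next
  case False
  then obtain q where q: "size \<mu> = Suc q" using nonempty_has_size gr0_implies_Suc by blast
  define x :: rat where "x = of_nat (c + ct_norm \<mu>)"
  define B where "B = (- 1) ^ q * of_nat (prod_mset \<mu>) * pochhammer (x + 1) q / (x + 1)"
  have x: "x \<ge> 1" using pos by (simp add: x_def)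
  have merged: "of_nat a * merge_coeff (c + a) (\<mu> - {#a#}) = B * (of_nat c + of_nat a)"
    if a: "a \<in># \<mu>" for a
  proof -
    have a2: "a \<ge> 2" using is_cycle_typeD[OF \<mu> a] .
    have "c + a + ct_norm (\<mu> - {#a#}) = c + ct_norm \<mu> + 1"
      using ct_norm_remove[OF a] a2 by simp
    then have "(of_nat (c + a + ct_norm (\<mu> - {#a#})) :: rat) = x + 1" by (simp add: x_def)
    moreover have "(of_nat (prod_mset \<mu>) :: rat) = of_nat a * of_nat (prod_mset (\<mu> - {#a#}))"
      by (metis a insert_DiffM of_nat_mult prod_mset.add_mset)
    moreover have "size (\<mu> - {#a#}) = q" using a q by (simp add: size_Diff_singleton)
    ultimately show ?thesis by (simp add: merge_coeff_def B_def)
  qed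
  have "(\<Sum>a\<in>#\<mu>. of_nat a * merge_coeff (c + a) (\<mu> - {#a#})) = (\<Sum>a\<in>#\<mu>. B * (of_nat c + of_nat a))"
    by (rule arg_cong[of _ _ sum_mset], rule image_mset_cong) (rule merged)
  also have "\<dots> = B * (\<Sum>a\<in>#\<mu>. of_nat c + of_nat a)" by (simp add: sum_mset_distrib_left multiset.map_comp comp_def)
  also have "(\<Sum>a\<in>#\<mu>. of_nat c + of_nat a :: rat) = of_nat (size \<mu>) * of_nat c + of_nat (sum_mset \<mu>)"
    by (induction \<mu>) (simp_all add: algebra_simps)
  also have "sum_mset \<mu> = ct_norm \<mu> + Suc q" using ct_norm_plus_size[OF \<mu>] q by simp
  finally have sum: "(\<Sum>a\<in>#\<mu>. of_nat a * merge_coeff (c + a) (\<mu> - {#a#})) =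
      B * (of_nat (Suc q) * (of_nat c + 1) + (x - of_nat c))"
    by (simp add: q x_def algebra_simps)
  have Bx: "B * (x + 1) = (- 1) ^ q * of_nat (prod_mset \<mu>) * pochhammer (x + 1) q"
    using x by (simp add: B_def)
  have "of_nat (c + 1 + ct_norm \<mu>) = x + 1" by (simp add: x_def)
  then have first: "merge_coeff (c + 1) \<mu> = - B * ((of_nat c + 1) * (x + 1 + of_nat q))"
    unfolding merge_coeff_def q B_def pochhammer_Suc by (simp only:) simp
  have "merge_coeff c \<mu> = - ((- 1) ^ q * of_nat (prod_mset \<mu>) * pochhammer (x + 1) q) * of_nat c"
    unfolding merge_coeff_def q x_def[symmetric] pochhammer_rec using x by simp
  also have "\<dots> = - B * (of_nat c * (x + 1))" unfolding Bx[symmetric] by simp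
  also have "\<dots> = - B * ((of_nat c + 1) * (x + 1 + of_nat q)) +
      B * (of_nat (Suc q) * (of_nat c + 1) + (x - of_nat c))"
    by (simp add: algebra_simps)
  finally show ?thesis unfolding sum first .
qed

text \<open>The coefficient of the \<open>(k+1)\<close>-cycle in the class \<open>\<nu>\<close> of norm \<open>k\<close>, modulo products of classes of
  smaller positive norm.  Up to normalization these are the coefficients of the \<open>(-k)\<close>-th power of a
  formal power series, which come from Lagrange inversion.\<close>

definition indecomposable_coeff :: "nat multiset \<Rightarrow> rat" where
  "indecomposable_coeff \<nu> = (- 1) ^ (size \<nu> - 1) * of_nat (prod_mset \<nu>) *
     pochhammer (of_nat (ct_norm \<nu> + 1)) (size \<nu> - 1) / of_nat (ct_norm \<nu> + 1)"

lemma indecomposable_coeff_add_mset: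
  assumes "c \<ge> 1"
  shows "indecomposable_coeff (add_mset c \<mu>) = merge_coeff c \<mu>"
proof -
  have "ct_norm (add_mset c \<mu>) + 1 = c + ct_norm \<mu>" using assms by simp
  then show ?thesis unfolding indecomposable_coeff_def merge_coeff_def by simp
qed

lemma indecomposable_coeff_nonzero:
  assumes "is_cycle_type \<nu>" "\<nu> \<noteq> {#}"
  shows "indecomposable_coeff \<nu> \<noteq> 0"
proof -
  have "0 \<notin># \<nu>" using assms(1) by (auto simp: is_cycle_type_def)
  then have "prod_mset \<nu> \<noteq> 0" by simp
  moreover have "pochhammer (of_nat (ct_norm \<nu> + 1) :: rat) (size \<nu> - 1) > 0"
    by (intro pochhammer_pos) simp
  ultimately show ?thesis by (simp add: indecomposable_coeff_def del: of_nat_add of_nat_Suc)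
qed

section \<open>Elimination by norm and number of parts\<close>

text \<open>The relations used for the elimination fail for arbitrary \<open>r\<close>, so equality is required at the
  admissible ones only.\<close>

definition expressible ::
    "(nat \<Rightarrow> nat multiset) \<Rightarrow> nat \<Rightarrow> (nat \<Rightarrow> (nat multiset \<Rightarrow> complex) \<Rightarrow> complex) \<Rightarrow> bool" where
  "expressible C k F \<longleftrightarrow>
     (\<exists>f\<in>poly_fun k. \<forall>n r. admissible n r \<longrightarrow> F n r = f n (\<lambda>i. r (C i)))"

lemma expressible_cong:
  "expressible C k F \<Longrightarrow> (\<And>n r. admissible n r \<Longrightarrow> G n r = F n r) \<Longrightarrow> expressible C k G"
  unfolding expressible_def by metis

lemma expressible_mono: "expressible C k F \<Longrightarrow> k \<le> l \<Longrightarrow> expressible C l F"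
  unfolding expressible_def using poly_fun_mono by metis

lemma expressible_poly: "expressible C k (\<lambda>n r. rat_poly_at p n)"
  unfolding expressible_def using poly_fun_const by metis

lemma expressible_const: "expressible C k (\<lambda>n r. of_rat c)"
  using expressible_poly[of C k "[:c:]"] by simp

lemma expressible_var: "1 \<le> i \<Longrightarrow> i \<le> k \<Longrightarrow> expressible C k (\<lambda>n r. r (C i))"
  unfolding expressible_def by (rule bexI[OF _ poly_fun_var]) auto

lemma expressible_add:
  assumes "expressible C k F" "expressible C k G"
  shows "expressible C k (\<lambda>n r. F n r + G n r)"
proof -
  obtain f g where "f \<in> poly_fun k" "g \<in> poly_fun k"
    and "\<And>n r. admissible n r \<Longrightarrow> F n r = f n (\<lambda>i. r (C i))"
    and "\<And>n r. admissible n r \<Longrightarrow> G n r = g n (\<lambda>i. r (C i))"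
    using assms unfolding expressible_def by blast
  then show ?thesis
    unfolding expressible_def by (intro bexI[of _ "\<lambda>n t. f n t + g n t"] poly_fun.add) auto
qed

lemma expressible_mult:
  assumes "expressible C k F" "expressible C k G"
  shows "expressible C k (\<lambda>n r. F n r * G n r)"
proof -
  obtain f g where "f \<in> poly_fun k" "g \<in> poly_fun k"
    and "\<And>n r. admissible n r \<Longrightarrow> F n r = f n (\<lambda>i. r (C i))"
    and "\<And>n r. admissible n r \<Longrightarrow> G n r = g n (\<lambda>i. r (C i))"
    using assms unfolding expressible_def by blast
  then show ?thesis
    unfolding expressible_def by (intro bexI[of _ "\<lambda>n t. f n t * g n t"] poly_fun_mult) auto
qed

lemma expressible_scale: "expressible C k F \<Longrightarrow> expressible C k (\<lambda>n r. of_rat c * F n r)"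
  by (rule expressible_mult[OF expressible_const])

lemma expressible_diff:
  assumes "expressible C k F" "expressible C k G"
  shows "expressible C k (\<lambda>n r. F n r - G n r)"
  using expressible_add[OF assms(1) expressible_scale[OF assms(2), of "- 1"]] by simp

lemma expressible_sum:
  assumes "\<And>i. i \<in> A \<Longrightarrow> expressible C k (F i)"
  shows "expressible C k (\<lambda>n r. \<Sum>i\<in>A. F i n r)"
  using assms
proof (induction A rule: infinite_finite_induct)
  case (insert i A)
  then show ?case using expressible_add[of C k "F i" "\<lambda>n r. \<Sum>i\<in>A. F i n r"] by simp
qed (use expressible_const[of C k 0] in simp_all)

lemma expressible_sum_mset:
  assumes "\<And>a. a \<in># M \<Longrightarrow> expressible C k (F a)"
  shows "expressible C k (\<lambda>n r. \<Sum>a\<in>#M. F a n r)"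
  using assms
proof (induction M)
  case empty
  show ?case using expressible_const[of C k 0] by simp
next
  case (add a M)
  then show ?case using expressible_add[of C k "F a" "\<lambda>n r. \<Sum>a\<in>#M. F a n r"] by simp
qed

text \<open>No step raises the norm by more than one, so a walk too short to reach norm \<open>k\<close> ends in states
  covered by the induction hypothesis.\<close>

lemma scaled_walk_lower:
  assumes lower: "\<And>\<nu>. is_cycle_type \<nu> \<Longrightarrow> ct_norm \<nu> < k \<Longrightarrow> expressible C d (scaled_value \<nu>)"
  shows "is_cycle_type \<mu> \<Longrightarrow> c \<ge> 1 \<Longrightarrow> c - 1 + ct_norm \<mu> + j < k \<Longrightarrow>
    expressible C d (scaled_walk j c \<mu>)"
proof (induction j arbitrary: c \<mu>)
  case 0
  show ?case
  proof (cases "c = 1")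
    case True
    have "expressible C d (\<lambda>n r. rat_poly_at [:- of_nat (sum_mset \<mu>), 1:] n * scaled_value \<mu> n r)"
      using 0 by (intro expressible_mult expressible_poly lower) auto
    then show ?thesis
      by (rule expressible_cong) (simp only: True One_nat_def scaled_walk_0)
  next
    case False
    then have "expressible C d (scaled_value (add_mset c \<mu>))"
      using 0 by (intro lower) auto
    then show ?thesis
      by (rule expressible_cong) (use False 0 in \<open>simp add: scaled_walk_0\<close>)
  qed
next
  case (Suc j)
  have "expressible C d (\<lambda>n r. scaled_walk j (c + 1) \<mu> n r
      + (\<Sum>a\<in>#\<mu>. of_rat (of_nat a) * scaled_walk j (c + a) (\<mu> - {#a#}) n r)
      + (\<Sum>i<c. rat_poly_at (split_factor (c + sum_mset \<mu>) i) n *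
          scaled_walk j (c - i) (\<mu> + cycle_part i) n r))"
  proof (intro expressible_add expressible_sum_mset expressible_sum expressible_scale
      expressible_mult[OF expressible_poly] Suc.IH)
    fix a assume a: "a \<in># \<mu>"
    show "c + a - 1 + ct_norm (\<mu> - {#a#}) + j < k"
      using Suc.prems ct_norm_remove[OF a] is_cycle_typeD[OF Suc.prems(1) a] by simp
  qed (use Suc.prems in \<open>auto simp: is_cycle_type_remove\<close>)
  then show ?case
    by (rule expressible_cong) (simp add: scaled_walk_Suc[OF Suc.prems(2)])
qed

text \<open>The error in replacing \<open>\<nu>\<close> by the corresponding multiple of a single cycle.\<close>

definition defect :: "nat multiset \<Rightarrow> nat \<Rightarrow> (nat multiset \<Rightarrow> complex) \<Rightarrow> complex" where
  "defect \<nu> n r = scaled_value \<nu> n r -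
     of_rat (indecomposable_coeff \<nu>) * scaled_value {#ct_norm \<nu> + 1#} n r"

text \<open>The unique way for a walk to keep all cycles of \<open>\<mu>\<close> separate without cutting is to move to a fixed point in
  every step; it ends in \<open>add_mset (c + j) \<mu>\<close>.  That state is the one whose defect is still unknown
  in the induction on the number of parts, so it is kept apart.\<close>

definition walk_residue ::
    "nat \<Rightarrow> nat \<Rightarrow> nat multiset \<Rightarrow> nat \<Rightarrow> (nat multiset \<Rightarrow> complex) \<Rightarrow> complex" where
  "walk_residue j c \<mu> n r = scaled_walk j c \<mu> n r
     - of_rat (merge_coeff c \<mu>) * scaled_value {#c + ct_norm \<mu> + j#} n r
     - defect (add_mset (c + j) \<mu>) n r"

lemma of_rat_sum_mset: "of_rat (\<Sum>a\<in>#M. f a) = (\<Sum>a\<in>#M. of_rat (f a) :: complex)"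
  by (induction M) (simp_all add: of_rat_add)

lemma merge_coeff_rec_times:
  fixes x :: complex
  assumes "is_cycle_type \<mu>" "c + ct_norm \<mu> \<ge> 1"
  shows "of_rat (merge_coeff c \<mu>) * x = of_rat (merge_coeff (c + 1) \<mu>) * x +
    (\<Sum>a\<in>#\<mu>. of_nat a * (of_rat (merge_coeff (c + a) (\<mu> - {#a#})) * x))"
proof -
  have "(\<Sum>a\<in>#\<mu>. of_nat a * (of_rat (merge_coeff (c + a) (\<mu> - {#a#})) * x)) =
      (\<Sum>a\<in>#\<mu>. of_rat (of_nat a * merge_coeff (c + a) (\<mu> - {#a#}))) * x"
    by (simp add: sum_mset_distrib_right multiset.map_comp comp_def mult.assoc of_rat_mult)
  then show ?thesis
    by (subst merge_coeff_rec[OF assms]) (simp add: of_rat_add of_rat_sum_mset distrib_right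
        multiset.map_comp comp_def)
qed

lemma sum_merged_residues:
  assumes \<mu>: "is_cycle_type \<mu>"
  shows "(\<Sum>a\<in>#\<mu>. of_rat (of_nat a) * (walk_residue j (c + a) (\<mu> - {#a#}) n r
        + defect (add_mset (c + a + j) (\<mu> - {#a#})) n r)) =
    (\<Sum>a\<in>#\<mu>. of_nat a * scaled_walk j (c + a) (\<mu> - {#a#}) n r) -
    (\<Sum>a\<in>#\<mu>. of_nat a * (of_rat (merge_coeff (c + a) (\<mu> - {#a#})) *
      scaled_value {#c + ct_norm \<mu> + j + 1#} n r))"
proof -
  have diff: "(\<Sum>a\<in>#M. f a) - (\<Sum>a\<in>#M. g a) = (\<Sum>a\<in>#M. f a - g a)"
    for f g :: "nat \<Rightarrow> complex" and M
    by (induction M) (simp_all add: algebra_simps)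
  have size: "c + a + ct_norm (\<mu> - {#a#}) + j = c + ct_norm \<mu> + j + 1" if "a \<in># \<mu>" for a
    using ct_norm_remove[OF that] is_cycle_typeD[OF \<mu> that] by simp
  show ?thesis
    unfolding diff
  proof (rule arg_cong[of _ _ sum_mset], rule image_mset_cong)
    fix a assume a: "a \<in># \<mu>"
    show "of_rat (of_nat a) * (walk_residue j (c + a) (\<mu> - {#a#}) n r
        + defect (add_mset (c + a + j) (\<mu> - {#a#})) n r) =
      of_nat a * scaled_walk j (c + a) (\<mu> - {#a#}) n r -
      of_nat a * (of_rat (merge_coeff (c + a) (\<mu> - {#a#})) *
        scaled_value {#c + ct_norm \<mu> + j + 1#} n r)"
      unfolding walk_residue_def size[OF a] by (simp add: right_diff_distrib)
  qed
qed

lemma merged_cycle_type: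
  assumes "is_cycle_type \<mu>" "a \<in># \<mu>"
  shows "is_cycle_type (add_mset (c + a) (\<mu> - {#a#}))"
    and "ct_norm (add_mset (c + a) (\<mu> - {#a#})) = c + ct_norm \<mu>"
    and "size (add_mset (c + a) (\<mu> - {#a#})) = size \<mu>"
  using assms is_cycle_typeD[OF assms] ct_norm_remove[OF assms(2)]
  by (auto simp: is_cycle_type_remove size_Suc_Diff1)

text \<open>When the norm \<open>k\<close> is reached only by merging in every step, cuts contribute lower terms, and a
  merge with a cycle of \<open>\<mu>\<close> leaves fewer parts, hence known defects.\<close>

lemma scaled_walk_top:
  assumes lower: "\<And>\<nu>. is_cycle_type \<nu> \<Longrightarrow> ct_norm \<nu> < k \<Longrightarrow> expressible C d (scaled_value \<nu>)"
    and fewer: "\<And>\<nu>. is_cycle_type \<nu> \<Longrightarrow> ct_norm \<nu> = k \<Longrightarrow> \<nu> \<noteq> {#} \<Longrightarrow> size \<nu> \<le> q \<Longrightarrow>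
      expressible C d (defect \<nu>)"
  shows "is_cycle_type \<mu> \<Longrightarrow> c \<ge> 1 \<Longrightarrow> c + j \<ge> 2 \<Longrightarrow> c - 1 + ct_norm \<mu> + j = k \<Longrightarrow> size \<mu> \<le> q \<Longrightarrow>
    expressible C d (walk_residue j c \<mu>)"
proof (induction j arbitrary: c \<mu>)
  case 0
  then have "c + ct_norm \<mu> = k + 1" by simp
  then have "walk_residue 0 c \<mu> n r = of_rat 0" for n r
    using 0 by (simp add: scaled_walk_0 walk_residue_def defect_def indecomposable_coeff_add_mset)
  then show ?case by (intro expressible_cong[OF expressible_const])
next
  case (Suc j)
  note prems = Suc.prems
  have merged: "expressible C d (defect (add_mset (c + a + j) (\<mu> - {#a#})))" if a: "a \<in># \<mu>" for a
    using merged_cycle_type[OF prems(1) a, of "c + j"] prems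
    by (intro fewer) (auto simp: ac_simps)
  have "expressible C d (\<lambda>n r. walk_residue j (c + 1) \<mu> n r
      + (\<Sum>a\<in>#\<mu>. of_rat (of_nat a) * (walk_residue j (c + a) (\<mu> - {#a#}) n r
          + defect (add_mset (c + a + j) (\<mu> - {#a#})) n r))
      + (\<Sum>i<c. rat_poly_at (split_factor (c + sum_mset \<mu>) i) n *
          scaled_walk j (c - i) (\<mu> + cycle_part i) n r))"
  proof (intro expressible_add expressible_sum_mset expressible_sum expressible_scale
      expressible_mult[OF expressible_poly])
    show "expressible C d (walk_residue j (c + 1) \<mu>)"
      using prems by (intro Suc.IH) auto
    show "expressible C d (walk_residue j (c + a) (\<mu> - {#a#}))" if a: "a \<in># \<mu>" for a
      using prems ct_norm_remove[OF a] is_cycle_typeD[OF prems(1) a] a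
      by (intro Suc.IH) (auto simp: is_cycle_type_remove size_Diff_singleton)
    show "expressible C d (scaled_walk j (c - i) (\<mu> + cycle_part i))" if "i \<in> {..<c}" for i
      by (rule scaled_walk_lower[OF lower]) (use prems that in auto)
  qed (rule merged)
  then show ?case
  proof (rule expressible_cong)
    fix n r
    show "walk_residue (Suc j) c \<mu> n r = walk_residue j (c + 1) \<mu> n r
      + (\<Sum>a\<in>#\<mu>. of_rat (of_nat a) * (walk_residue j (c + a) (\<mu> - {#a#}) n r
          + defect (add_mset (c + a + j) (\<mu> - {#a#})) n r))
      + (\<Sum>i<c. rat_poly_at (split_factor (c + sum_mset \<mu>) i) n *
          scaled_walk j (c - i) (\<mu> + cycle_part i) n r)"
      unfolding sum_merged_residues[OF prems(1)]
      unfolding walk_residue_def scaled_walk_Suc[OF prems(2)]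
      using prems merge_coeff_rec_times[of \<mu> c "scaled_value {#c + ct_norm \<mu> + j + 1#} n r"]
      by simp
  qed
qed

text \<open>Write \<open>\<nu> = \<mu> \<union> {m + 1}\<close>.  In the relation for \<open>\<mu>\<close> and walks of length \<open>m\<close> the product is
  expressible, being made of values of smaller norm; the multiples of the single cycle cancel by
  \<open>merge_coeff_rec\<close> at \<open>c = 0\<close>; and every defect other than that of \<open>\<nu>\<close> belongs to a class with fewer
  parts.\<close>

lemma defect_expressible:
  assumes lower: "\<And>\<nu>. is_cycle_type \<nu> \<Longrightarrow> ct_norm \<nu> < k \<Longrightarrow> expressible C d (scaled_value \<nu>)"
  shows "is_cycle_type \<nu> \<Longrightarrow> ct_norm \<nu> = k \<Longrightarrow> \<nu> \<noteq> {#} \<Longrightarrow> expressible C d (defect \<nu>)"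
proof (induction "size \<nu>" arbitrary: \<nu> rule: less_induct)
  case less
  obtain b \<mu> where "\<nu> = add_mset b \<mu>" using less.prems(3) by (cases \<nu>) auto
  moreover define m where "m = b - 1"
  ultimately have \<nu>: "\<nu> = add_mset (1 + m) \<mu>" and m: "m \<ge> 1" and \<mu>: "is_cycle_type \<mu>"
    and k: "k = m + ct_norm \<mu>"
    using less.prems by auto
  show ?case
  proof (cases "\<mu> = {#}")
    case True
    then have "defect \<nu> n r = of_rat 0" for n r
      unfolding \<nu> by (simp add: defect_def indecomposable_coeff_def)
    then show ?thesis by (intro expressible_cong[OF expressible_const])
  next
    case False
    have norm_pos: "ct_norm \<mu> \<ge> 1" using ct_norm_pos[OF \<mu> False] .
    have fewer: "expressible C d (defect \<nu>')"
      if "is_cycle_type \<nu>'" "ct_norm \<nu>' = k" "\<nu>' \<noteq> {#}" "size \<nu>' \<le> size \<mu>" for \<nu>'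
      using less.hyps[of \<nu>'] that by (simp add: \<nu>)
    have "expressible C d (\<lambda>n r. scaled_value \<mu> n r * scaled_walk m 1 {#} n r
        - walk_residue m 1 \<mu> n r
        - (\<Sum>a\<in>#\<mu>. of_rat (of_nat a) * (walk_residue m (0 + a) (\<mu> - {#a#}) n r
            + defect (add_mset (0 + a + m) (\<mu> - {#a#})) n r)))"
    proof (intro expressible_diff expressible_mult expressible_sum_mset expressible_add)
      show "expressible C d (scaled_value \<mu>)" using \<mu> m k by (intro lower) auto
      show "expressible C d (scaled_walk m 1 {#})"
        by (rule scaled_walk_lower[OF lower]) (use norm_pos k in auto)
      show "expressible C d (walk_residue m 1 \<mu>)"
        by (rule scaled_walk_top[OF lower fewer]) (use \<mu> m k in auto)
      fix a assume a: "a \<in># \<mu>"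
      show "expressible C d (\<lambda>n r. of_rat (of_nat a))" by (rule expressible_const)
      show "expressible C d (walk_residue m (0 + a) (\<mu> - {#a#}))"
        using ct_norm_remove[OF a] is_cycle_typeD[OF \<mu> a] \<mu> a m k
        by (intro scaled_walk_top[OF lower fewer]) (auto simp: is_cycle_type_remove size_Diff_singleton)
      show "expressible C d (defect (add_mset (0 + a + m) (\<mu> - {#a#})))"
        using merged_cycle_type[OF \<mu> a, of m] k by (intro fewer) (auto simp: ac_simps)
    qed
    then show ?thesis
    proof (rule expressible_cong)
      fix n r assume adm: "admissible n r"
      show "defect \<nu> n r = scaled_value \<mu> n r * scaled_walk m 1 {#} n r
        - walk_residue m 1 \<mu> n r
        - (\<Sum>a\<in>#\<mu>. of_rat (of_nat a) * (walk_residue m (0 + a) (\<mu> - {#a#}) n r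
            + defect (add_mset (0 + a + m) (\<mu> - {#a#})) n r))"
        unfolding sum_merged_residues[OF \<mu>]
        unfolding admissible_scaled_walk[OF adm \<mu>] walk_residue_def \<nu>
        using norm_pos
          merge_coeff_rec_times[OF \<mu>, of 0 "scaled_value {#0 + ct_norm \<mu> + m + 1#} n r"]
        by (simp add: merge_coeff_def[of 0])
    qed
  qed
qed

text \<open>The coefficient of \<open>C k\<close> is nonzero, so the value at the \<open>(k+1)\<close>-cycle can be recovered from the value at
  \<open>C k\<close>, and with it the value at any class of norm \<open>k\<close>.\<close>

theorem scaled_value_expressible:
  assumes C_type: "\<And>k. k \<ge> 1 \<Longrightarrow> is_cycle_type (C k)"
    and C_norm: "\<And>k. k \<ge> 1 \<Longrightarrow> ct_norm (C k) = k"
  shows "is_cycle_type \<nu> \<Longrightarrow> expressible C (ct_norm \<nu>) (scaled_value \<nu>)"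
proof (induction "ct_norm \<nu>" arbitrary: \<nu> rule: less_induct)
  case less
  define k where "k = ct_norm \<nu>"
  show ?case
  proof (cases "\<nu> = {#}")
    case True
    have "expressible C 0 (\<lambda>n r. of_rat 1)" by (rule expressible_const)
    then have "expressible C 0 (scaled_value {#})"
      by (rule expressible_cong) (simp add: scaled_value_def falling_poly_0 admissible_def)
    then show ?thesis by (simp add: True)
  next
    case False
    then have k1: "k \<ge> 1" using ct_norm_pos less.prems by (simp add: k_def)
    have lower: "expressible C k (scaled_value \<nu>')" if "is_cycle_type \<nu>'" "ct_norm \<nu>' < k" for \<nu>'
      using less.hyps[of \<nu>'] that by (auto simp: k_def intro: expressible_mono)
    have defect: "expressible C k (defect \<nu>')"
      if "is_cycle_type \<nu>'" "ct_norm \<nu>' = k" "\<nu>' \<noteq> {#}" for \<nu>'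
      by (rule defect_expressible[of k]) (use lower that in auto)
    let ?x = "scaled_value {#k + 1#}"
    have Ck: "is_cycle_type (C k)" "ct_norm (C k) = k" "C k \<noteq> {#}"
      using C_type[OF k1] C_norm[OF k1] k1 by auto
    define l where "l = indecomposable_coeff (C k)"
    have l: "l \<noteq> 0" unfolding l_def by (rule indecomposable_coeff_nonzero[OF Ck(1,3)])
    have "expressible C k (\<lambda>n r. rat_poly_at (falling_poly (sum_mset (C k))) n * r (C k))"
      using k1 by (intro expressible_mult expressible_poly expressible_var) auto
    then have "expressible C k (scaled_value (C k))"
      by (rule expressible_cong) (simp add: scaled_value_def)
    then have "expressible C k (\<lambda>n r. of_rat (1 / l) * (scaled_value (C k) n r - defect (C k) n r))"
      by (intro expressible_scale expressible_diff defect[OF Ck])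
    then have x: "expressible C k ?x"
      by (rule expressible_cong) (use l in \<open>simp add: defect_def Ck l_def[symmetric] of_rat_divide\<close>)
    have "expressible C k (\<lambda>n r. defect \<nu> n r + of_rat (indecomposable_coeff \<nu>) * ?x n r)"
      using less.prems False by (intro expressible_add expressible_scale x defect) (simp_all add: k_def)
    then show ?thesis
      unfolding k_def[symmetric] by (rule expressible_cong) (simp add: defect_def k_def)
  qed
qed

section \<open>Cycles of permutations\<close>

text \<open>Read from right to left this merges two disjoint cycles; composed with the same transposition it
  cuts one cycle in two.  Both kinds of step of a walk rest on this identity.\<close>

lemma cycle_of_list_append:
  assumes "distinct (as @ bs)" "as \<noteq> []" "bs \<noteq> []"
  shows "cycle_of_list (as @ bs) = transpose (hd as) (hd bs) \<circ> cycle_of_list as \<circ> cycle_of_list bs"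
  using assms
proof (induction as rule: cycle_of_list.induct)
  case (1 a a' as)
  obtain b bs' where bs: "bs = b # bs'" using 1 by (cases bs) auto
  have swap: "transpose a a' \<circ> transpose a' b = transpose a b \<circ> transpose a a'"
    using 1 by (auto simp: fun_eq_iff transpose_def bs)
  have "cycle_of_list ((a # a' # as) @ bs) =
      transpose a a' \<circ> (transpose a' b \<circ> cycle_of_list (a' # as) \<circ> cycle_of_list bs)"
    using 1 by (simp add: bs fun_eq_iff)
  also have "\<dots> = (transpose a a' \<circ> transpose a' b) \<circ> cycle_of_list (a' # as) \<circ> cycle_of_list bs"
    by (simp only: o_assoc)
  also have "\<dots> = transpose a b \<circ> (transpose a a' \<circ> cycle_of_list (a' # as)) \<circ> cycle_of_list bs"
    unfolding swap by (simp only: o_assoc)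
  finally show ?case by (simp add: bs)
qed (auto simp: neq_Nil_conv)

lemma cycle_of_list_nth:
  assumes "distinct B" "i < length B"
  shows "(cycle_of_list B ^^ k) (B ! i) = B ! ((k + i) mod length B)"
proof -
  have "map (cycle_of_list B ^^ k) B ! i = rotate k B ! i"
    by (simp only: cyclic_rotation[OF assms(1)])
  then show ?thesis using assms by (simp add: nth_rotate)
qed

lemma orbit_cycle_of_list:
  assumes "distinct B" "x \<in> set B"
  shows "orbit (cycle_of_list B) x = set B"
proof -
  obtain i where i: "i < length B" "x = B ! i" using assms(2) by (auto simp: in_set_conv_nth)
  have "orbit (cycle_of_list B) x = {B ! ((k + i) mod length B) | k. True}"
    unfolding orbit_altdef_permutation[OF permutation_of_cycle] i(2)
    by (simp add: cycle_of_list_nth[OF assms(1) i(1)])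
  also have "\<dots> = set B"
  proof (intro equalityI subsetI)
    fix z assume "z \<in> {B ! ((k + i) mod length B) | k. True}"
    moreover have "length B > 0" using i by linarith
    ultimately show "z \<in> set B" by auto
  next
    fix z assume "z \<in> set B"
    then obtain l where l: "l < length B" "z = B ! l" by (auto simp: in_set_conv_nth)
    have "((l + length B - i) + i) mod length B = l" using i l by simp
    then have "z = B ! (((l + length B - i) + i) mod length B)" using l by simp
    then show "z \<in> {B ! ((k + i) mod length B) | k. True}" by blast
  qed
  finally show ?thesis .
qed

lemma finite_moved: "permutation g \<Longrightarrow> finite {x. g x \<noteq> x}"
  by (simp add: permutation)

lemma cycle_type_cycle_comp:
  assumes B: "distinct B" and h: "h permutes S" "finite S" and disj: "S \<inter> set B = {}"
  shows "cycle_type (cycle_of_list B \<circ> h) = cycle_type h + cycle_part (length B)"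
proof (cases "length B \<ge> 2")
  case False
  then have "cycle_of_list B = id" by (cases B rule: cycle_of_list.cases) auto
  then show ?thesis using False by (simp add: cycle_part_def)
next
  case True
  let ?g = "cycle_of_list B \<circ> h"
  have h_perm: "permutation h" using h permutation_permutes by blast
  have h_out: "h x = x" if "x \<in> set B" for x
    using permutes_not_in[OF h(1), of x] that disj by blast
  have h_in: "h x \<notin> set B" if "x \<notin> set B" for x
  proof
    assume "h x \<in> set B"
    moreover from this have "h x = x"
      using h_out[of "h x"] permutes_inj[OF h(1)] by (simp add: inj_eq)
    ultimately show False using that by simp
  qed
  have g_in: "?g x = cycle_of_list B x" if "x \<in> set B" for x using h_out[OF that] by simp
  have g_out: "?g x = h x" if "x \<notin> set B" for x using h_in[OF that] by (simp add: id_outside_supp)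
  have orb_in: "orbit ?g x = set B" if "x \<in> set B" for x
  proof -
    have "orbit ?g x = orbit (cycle_of_list B) x"
      by (rule sym, rule orbit_cong0[of x "set B"])
         (use that g_in cycle_is_surj[OF B] in auto)
    then show ?thesis using orbit_cycle_of_list[OF B that] by simp
  qed
  have orb_out: "orbit ?g x = orbit h x" if "x \<notin> set B" for x
    by (rule sym, rule orbit_cong0[of x "- set B"]) (use that g_out h_in in auto)
  have moved_B: "?g x \<noteq> x" if "x \<in> set B" for x
  proof
    assume "?g x = x"
    then have "orbit ?g x = {x}" by (rule orbit_eq_singleton_iff[THEN iffD2])
    then have "set B = {x}" using orb_in[OF that] by (simp only:)
    then have "card (set B) = 1" by simp
    then show False using True distinct_card[OF B] by simp
  qed
  have moved: "{x. ?g x \<noteq> x} = set B \<union> {x. h x \<noteq> x}"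
  proof (rule Set.set_eqI)
    fix x
    show "x \<in> {x. ?g x \<noteq> x} \<longleftrightarrow> x \<in> set B \<union> {x. h x \<noteq> x}"
    proof (cases "x \<in> set B")
      case True
      then show ?thesis using moved_B[OF True] by blast
    next
      case False
      then show ?thesis unfolding mem_Collect_eq Un_iff g_out[OF False] by blast
    qed
  qed
  have "orbit ?g ` {x. ?g x \<noteq> x} = orbit ?g ` set B \<union> orbit ?g ` {x. h x \<noteq> x}"
    unfolding moved by (rule image_Un)
  also have "orbit ?g ` set B = {set B}"
    using orb_in True by (cases B) auto
  also have "orbit ?g ` {x. h x \<noteq> x} = orbit h ` {x. h x \<noteq> x}"
    by (rule image_cong) (use orb_out h_out in auto)
  finally have orbits: "orbit ?g ` {x. ?g x \<noteq> x} = insert (set B) (orbit h ` {x. h x \<noteq> x})"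
    by (simp only: insert_is_Un[symmetric])
  have "set B \<notin> orbit h ` {x. h x \<noteq> x}"
  proof
    assume "set B \<in> orbit h ` {x. h x \<noteq> x}"
    then obtain x where "h x \<noteq> x" "x \<in> set B" using permutation_self_in_orbit[OF h_perm] by auto
    then show False using h_out by blast
  qed
  then have "cycle_type ?g = add_mset (card (set B)) (cycle_type h)"
    unfolding cycle_type_def orbits using finite_moved[OF h_perm] by simp
  then show ?thesis using True by (simp add: cycle_part_def distinct_card[OF B])
qed

text \<open>The cycle is written as a list starting at \<open>y\<close>, so that \<open>hd B\<close> can serve as the current point of
  a walk.\<close>

lemma split_off_cycle:
  assumes h: "h permutes S" "finite S" and y: "y \<in> S"
  obtains B h' where "distinct B" "B \<noteq> []" "hd B = y" "set B \<subseteq> S" "h' permutes (S - set B)"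
    "h = cycle_of_list B \<circ> h'" "length B = card (orbit h y)"
proof -
  have perm: "permutation h" using h permutation_permutes by blast
  define B where "B = support h y"
  define h' where "h' = (\<lambda>z. if z \<in> S - set B then h z else z)"
  have dist: "distinct B" unfolding B_def by (rule cycle_of_permutation[OF perm])
  have set_B: "set B = orbit h y"
    unfolding B_def support_set[OF perm] orbit_altdef_permutation[OF perm] by auto
  have pos: "least_power h y > 0" by (rule least_power_of_permutation(2)[OF perm])
  then have "B \<noteq> []" "hd B = y" by (auto simp: B_def hd_map)
  moreover have sub: "set B \<subseteq> S" unfolding set_B by (rule permutes_orbit_subset[OF h(1) y])
  moreover have h': "h' permutes (S - set B)"
    unfolding h'_def B_def by (rule semidecomposition[OF h])
  moreover have "h = cycle_of_list B \<circ> h'"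
  proof
    fix z
    consider "z \<in> set B" | "z \<in> S - set B" | "z \<notin> S" by blast
    then show "h z = (cycle_of_list B \<circ> h') z"
    proof cases
      case 1
      then show ?thesis using cycle_restrict[OF perm, of z y] by (simp add: h'_def B_def)
    next
      case 2
      then have "h' z \<in> S - set B" using permutes_in_image[OF h'] by blast
      then show ?thesis using 2 by (simp add: h'_def id_outside_supp)
    next
      case 3
      then have "z \<notin> set B" using sub by blast
      then show ?thesis using 3 permutes_not_in[OF h(1)] by (simp add: h'_def id_outside_supp)
    qed
  qed
  moreover have "length B = card (orbit h y)" using distinct_card[OF dist] set_B by simp
  ultimately show ?thesis using that dist by blast
qed

lemma cycle_typeE:
  assumes "a \<in># cycle_type h" "h permutes S" "finite S"
  obtains y where "y \<in> S" "h y \<noteq> y" "a = card (orbit h y)"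
proof -
  have "permutation h" using assms permutation_permutes by blast
  then obtain y where "h y \<noteq> y" "a = card (orbit h y)"
    using assms(1) finite_moved[of h] by (auto simp: cycle_type_def)
  then show ?thesis using that permutes_not_in[OF assms(2)] by blast
qed

lemma is_cycle_type_cycle_type:
  assumes "h permutes S" "finite S"
  shows "is_cycle_type (cycle_type h)"
  unfolding is_cycle_type_def
proof
  fix a assume "a \<in># cycle_type h"
  then obtain y where y: "y \<in> S" "h y \<noteq> y" "a = card (orbit h y)" using assms by (rule cycle_typeE)
  have perm: "permutation h" using assms permutation_permutes by blast
  have "finite (orbit h y)" "{y, h y} \<subseteq> orbit h y"
    using finite_orbit[of y h] permutation_self_in_orbit[OF perm] by (auto intro: orbit.base)
  then have "card {y, h y} \<le> card (orbit h y)" by (rule card_mono)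
  then show "a \<ge> 2" using y by (simp add: eq_commute)
qed

lemma sum_over_points_by_cycle:
  fixes G :: "nat \<Rightarrow> 'a::comm_ring_1"
  assumes h: "h permutes S" "finite S"
  shows "(\<Sum>y\<in>S. G (card (orbit h y))) =
    (of_nat (card S) - of_nat (sum_mset (cycle_type h))) * G 1 + (\<Sum>a\<in>#cycle_type h. of_nat a * G a)"
proof -
  let ?M = "{x. h x \<noteq> x}"
  have perm: "permutation h" using h permutation_permutes by blast
  have M: "?M \<subseteq> S" using permutes_not_in[OF h(1)] by blast
  then have fin: "finite ?M" using h finite_subset by blast
  have moved: "(\<Sum>y\<in>?M. F (card (orbit h y))) = (\<Sum>a\<in>#cycle_type h. of_nat a * F a)"
    for F :: "nat \<Rightarrow> 'b::comm_ring_1"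
  proof -
    have "(\<Sum>y\<in>?M. F (card (orbit h y))) =
        (\<Sum>O'\<in>orbit h ` ?M. \<Sum>y\<in>{y\<in>?M. orbit h y = O'}. F (card (orbit h y)))"
      by (rule sum.image_gen[OF fin])
    also have "\<dots> = (\<Sum>O'\<in>orbit h ` ?M. of_nat (card O') * F (card O'))"
    proof (rule sum.cong[OF refl])
      fix O' assume "O' \<in> orbit h ` ?M"
      then obtain x where x: "h x \<noteq> x" "O' = orbit h x" by blast
      have cyc: "cyclic_on h O'" unfolding x by (rule cyclic_on_orbit'[OF perm])
      have "{y\<in>?M. orbit h y = O'} = O'"
      proof (intro equalityI subsetI)
        fix y assume "y \<in> {y\<in>?M. orbit h y = O'}"
        then show "y \<in> O'" using permutation_self_in_orbit[OF perm, of y] by auto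
      next
        fix y assume y: "y \<in> O'"
        then have orb: "orbit h y = O'" by (rule orbit_cyclic_eq3[OF cyc])
        have "h y \<noteq> y"
        proof
          assume "h y = y"
          then have "orbit h x = {y}" using orb x orbit_eq_singleton_iff by metis
          then have "orbit h x = {x}" using permutation_self_in_orbit[OF perm, of x] by auto
          then show False using x orbit_eq_singleton_iff by metis
        qed
        then show "y \<in> {y\<in>?M. orbit h y = O'}" using orb by simp
      qed
      moreover have "(\<Sum>y\<in>{y\<in>?M. orbit h y = O'}. F (card (orbit h y))) =
          (\<Sum>y\<in>{y\<in>?M. orbit h y = O'}. F (card O'))"
        by (rule sum.cong) auto
      ultimately show "(\<Sum>y\<in>{y\<in>?M. orbit h y = O'}. F (card (orbit h y))) =
          of_nat (card O') * F (card O')"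
        by (simp only: sum_constant)
    qed
    also have "\<dots> = (\<Sum>a\<in>#cycle_type h. of_nat a * F a)"
      by (simp add: cycle_type_def sum_unfold_sum_mset multiset.map_comp comp_def)
    finally show ?thesis .
  qed
  have of_nat_sum: "int (sum_mset N) = (\<Sum>a\<in>#N. int a)" for N
    by (induction N) simp_all
  have "int (card ?M) = int (sum_mset (cycle_type h))"
    unfolding of_nat_sum using moved[of "\<lambda>_. 1 :: int"] by simp
  then have card_M: "card ?M = sum_mset (cycle_type h)" by (simp only: of_nat_eq_iff)
  have "(\<Sum>y\<in>S. G (card (orbit h y))) =
      (\<Sum>y\<in>S - ?M. G (card (orbit h y))) + (\<Sum>y\<in>?M. G (card (orbit h y)))"
    using h M by (intro sum.subset_diff)
  also have "(\<Sum>y\<in>S - ?M. G (card (orbit h y))) = (\<Sum>y\<in>S - ?M. G 1)"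
  proof (rule sum.cong[OF refl])
    fix y assume "y \<in> S - ?M"
    then have "orbit h y = {y}" by (simp add: orbit_eq_singleton_iff)
    then show "G (card (orbit h y)) = G 1" by simp
  qed
  also have "\<dots> = of_nat (card S - card ?M) * G 1" using card_Diff_subset[OF fin M] by simp
  also have "\<dots> = (of_nat (card S) - of_nat (sum_mset (cycle_type h))) * G 1"
    using card_mono[OF h(2) M] unfolding card_M[symmetric] by (simp add: of_nat_diff)
  finally show ?thesis unfolding moved .
qed

text \<open>The sum of \<open>F\<close> over the end points of all walks of a given length that start at \<open>g\<close> with
  current point \<open>y\<close>.\<close>

fun walk_sum :: "((nat \<Rightarrow> nat) \<Rightarrow> complex) \<Rightarrow> nat \<Rightarrow> nat \<Rightarrow> nat \<Rightarrow> (nat \<Rightarrow> nat) \<Rightarrow> complex" where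
  "walk_sum F n 0 y g = F g"
| "walk_sum F n (Suc j) y g = (\<Sum>y'\<in>{1..n}. walk_sum F n j y' (transpose y y' \<circ> g))"

text \<open>A step to the \<open>i\<close>-th entry of the current cycle cuts the list \<open>L\<close> at that entry; a step to a point
  outside splits off the cycle \<open>B\<close> of that point and prepends it to \<open>L\<close>.  In both cases the new list
  starts at the new current point.\<close>

lemma walk_sum_eq_walk_value:
  assumes "distinct L" "L \<noteq> []" "set L \<subseteq> {1..n}" "h permutes ({1..n} - set L)"
  shows "walk_sum (\<lambda>g. r (cycle_type g)) n j (hd L) (cycle_of_list L \<circ> h) =
    walk_value r n j (length L) (cycle_type h)"
  using assms
proof (induction j arbitrary: L h)
  case 0
  have "cycle_type (cycle_of_list L \<circ> h) = cycle_type h + cycle_part (length L)"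
    by (rule cycle_type_cycle_comp[OF 0(1,4)]) auto
  then show ?case by (simp only: walk_sum.simps walk_value.simps)
next
  case (Suc j)
  let ?F = "\<lambda>g. r (cycle_type g)"
  let ?S = "{1..n} - set L"
  let ?c = "length L"
  let ?\<mu> = "cycle_type h"
  let ?f = "\<lambda>y'. walk_sum ?F n j y' (transpose (hd L) y' \<circ> (cycle_of_list L \<circ> h))"
  have cut: "?f (L ! i) = walk_value r n j (?c - i) (?\<mu> + cycle_part i)" if i: "i < ?c" for i
  proof -
    let ?T = "take i L" and ?D = "drop i L"
    have TD: "?T @ ?D = L" "set ?T \<union> set ?D = set L" by (simp_all flip: set_append)
    have "distinct (?T @ ?D)" using Suc.prems(1) by simp
    then have dist: "distinct ?T" "distinct ?D" "set ?T \<inter> set ?D = {}" by (auto simp only: distinct_append)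
    have D: "?D \<noteq> []" "hd ?D = L ! i" using i by (auto simp: hd_drop_conv_nth)
    have "transpose (hd L) (L ! i) \<circ> cycle_of_list L = cycle_of_list ?T \<circ> cycle_of_list ?D"
    proof (cases "i = 0")
      case True
      then show ?thesis using Suc.prems(2) by (simp add: hd_conv_nth)
    next
      case False
      then have T: "?T \<noteq> []" "hd ?T = hd L" using Suc.prems(2) by auto
      have "cycle_of_list L = transpose (hd L) (L ! i) \<circ> cycle_of_list ?T \<circ> cycle_of_list ?D"
        using cycle_of_list_append[of ?T ?D] Suc.prems(1) T D by simp
      then show ?thesis by (simp add: o_assoc)
    qed
    also have "\<dots> = cycle_of_list ?D \<circ> cycle_of_list ?T" by (rule cycles_commute[OF dist])
    finally have eq: "transpose (hd L) (L ! i) \<circ> (cycle_of_list L \<circ> h) =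
        cycle_of_list ?D \<circ> (cycle_of_list ?T \<circ> h)"
      by (simp only: o_assoc)
    have "h permutes ({1..n} - set ?D)"
      using Suc.prems(4) by (rule permutes_subset) (use TD in auto)
    moreover have "cycle_of_list ?T permutes ({1..n} - set ?D)"
      by (rule permutes_subset[OF cycle_permutes]) (use dist Suc.prems(3) set_take_subset[of i L] in auto)
    ultimately have perm: "(cycle_of_list ?T \<circ> h) permutes ({1..n} - set ?D)"
      by (rule permutes_compose)
    have sub: "set ?D \<subseteq> {1..n}" using Suc.prems(3) TD by auto
    have lens: "length ?D = ?c - i" "length ?T = i" using i by auto
    have "?f (L ! i) = walk_value r n j (length ?D) (cycle_type (cycle_of_list ?T \<circ> h))"
      unfolding eq using Suc.IH[OF dist(2) D(1) sub perm] unfolding D(2) .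
    also have "cycle_type (cycle_of_list ?T \<circ> h) = ?\<mu> + cycle_part (length ?T)"
      by (rule cycle_type_cycle_comp[OF dist(1) Suc.prems(4)]) (use TD in auto)
    finally show ?thesis unfolding lens .
  qed
  have join: "?f y' = walk_value r n j (?c + card (orbit h y')) (?\<mu> - cycle_part (card (orbit h y')))"
    if y': "y' \<in> ?S" for y'
  proof -
    obtain B h' where B: "distinct B" "B \<noteq> []" "hd B = y'" "set B \<subseteq> ?S" "h' permutes (?S - set B)"
      and h: "h = cycle_of_list B \<circ> h'" and len: "length B = card (orbit h y')"
      using split_off_cycle[OF Suc.prems(4) finite_Diff[OF finite_atLeastAtMost] y'] by blast
    have dist: "distinct (B @ L)" and disj: "set B \<inter> set L = {}" using B Suc.prems(1) by auto
    \<comment> \<open>The two cycles are swapped first, so that the merged list starts at the new point.\<close>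
    have "transpose (hd L) y' \<circ> (cycle_of_list L \<circ> h) =
        transpose (hd B) (hd L) \<circ> (cycle_of_list L \<circ> cycle_of_list B) \<circ> h'"
      unfolding h B(3) by (simp only: o_assoc transpose_commute)
    also have "cycle_of_list L \<circ> cycle_of_list B = cycle_of_list B \<circ> cycle_of_list L"
      by (rule cycles_commute) (use Suc.prems(1) B disj in auto)
    also have "transpose (hd B) (hd L) \<circ> (cycle_of_list B \<circ> cycle_of_list L) = cycle_of_list (B @ L)"
      using cycle_of_list_append[OF dist B(2) Suc.prems(2)] by (simp only: o_assoc)
    finally have eq: "transpose (hd L) y' \<circ> (cycle_of_list L \<circ> h) = cycle_of_list (B @ L) \<circ> h'" .
    have "{1..n} - set (B @ L) = ?S - set B" by auto
    then have perm: "h' permutes ({1..n} - set (B @ L))" using B(5) by simp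
    have sub: "set (B @ L) \<subseteq> {1..n}" using B(4) Suc.prems(3) by auto
    have ne: "B @ L \<noteq> []" and hd: "hd (B @ L) = y'" using B by auto
    have "?f y' = walk_value r n j (length (B @ L)) (cycle_type h')"
      unfolding eq using Suc.IH[OF dist ne sub perm] unfolding hd .
    moreover have "?\<mu> = cycle_type h' + cycle_part (length B)"
      unfolding h by (rule cycle_type_cycle_comp[OF B(1,5)]) auto
    ultimately show ?thesis by (simp add: len add.commute)
  qed
  have "walk_sum ?F n (Suc j) (hd L) (cycle_of_list L \<circ> h) = (\<Sum>y'\<in>?S. ?f y') + (\<Sum>y'\<in>set L. ?f y')"
    unfolding walk_sum.simps(2) by (rule sum.subset_diff[OF Suc.prems(3)]) simp
  also have "(\<Sum>y'\<in>set L. ?f y') = (\<Sum>i<?c. ?f (L ! i))"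
    by (rule sum.reindex_bij_betw[symmetric, OF bij_betw_nth]) (use Suc.prems(1) in auto)
  also have "\<dots> = (\<Sum>i<?c. walk_value r n j (?c - i) (?\<mu> + cycle_part i))"
    by (rule sum.cong) (auto simp only: cut lessThan_iff)
  also have "(\<Sum>y'\<in>?S. ?f y') =
      (\<Sum>y'\<in>?S. walk_value r n j (?c + card (orbit h y')) (?\<mu> - cycle_part (card (orbit h y'))))"
    by (rule sum.cong) (auto simp only: join)
  also have "\<dots> = (of_nat (card ?S) - of_nat (sum_mset ?\<mu>)) * walk_value r n j (?c + 1) (?\<mu> - cycle_part 1)
      + (\<Sum>a\<in>#?\<mu>. of_nat a * walk_value r n j (?c + a) (?\<mu> - cycle_part a))"
    by (rule sum_over_points_by_cycle[OF Suc.prems(4)]) simp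
  also have "(\<Sum>a\<in>#?\<mu>. of_nat a * walk_value r n j (?c + a) (?\<mu> - cycle_part a)) =
      (\<Sum>a\<in>#?\<mu>. of_nat a * walk_value r n j (?c + a) (?\<mu> - {#a#}))"
    using is_cycle_typeD[OF is_cycle_type_cycle_type[OF Suc.prems(4)]]
    by (intro arg_cong[of _ _ sum_mset] image_mset_cong) (auto simp: cycle_part_def)
  also have "card ?S = n - ?c"
    using Suc.prems(1,3) by (simp add: card_Diff_subset distinct_card)
  also have "?\<mu> - cycle_part 1 = ?\<mu>" by (simp add: cycle_part_def)
  also have "(of_nat (n - ?c) :: complex) = of_nat n - of_nat ?c"
    using card_mono[OF _ Suc.prems(3)] Suc.prems(1) by (simp add: distinct_card of_nat_diff)
  finally show ?case by (simp only: walk_value.simps of_nat_add diff_diff_eq)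
qed


text \<open>Match a cycle of \<open>g\<close> with a cycle of \<open>g'\<close> of the same length, entry by entry, and continue with
  the remaining points.  Two carriers are needed because the remaining points differ.\<close>

lemma ex_conjugating_bij:
  assumes "g permutes A" "g' permutes A'" "finite A" "finite A'" "card A = card A'"
    "cycle_type g = cycle_type g'"
  shows "\<exists>p. bij_betw p A A' \<and> (\<forall>x\<in>A. p (g x) = g' (p x))"
  using assms
proof (induction "size (cycle_type g)" arbitrary: g g' A A')
  case 0
  have fixed: "f x = x" if f: "f permutes S" "finite S" "cycle_type f = {#}" for f :: "nat \<Rightarrow> nat" and S x
  proof (rule ccontr)
    assume "f x \<noteq> x"
    moreover have "finite {x. f x \<noteq> x}"
      using f permutation_permutes by (blast intro: finite_moved)
    ultimately show False using f(3) by (auto simp: cycle_type_def mset_set_empty_iff)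
  qed
  obtain p where "bij_betw p A A'"
    using finite_same_card_bij[OF 0(4,5,6)] by blast
  moreover have type: "cycle_type g = {#}" using 0(1) by simp
  moreover have "g x = x" "g' x = x" for x
    using fixed[OF 0(2,4) type] fixed[OF 0(3,5)] type 0(7) by simp_all
  ultimately show ?case by auto
next
  case (Suc k)
  obtain a where a: "a \<in># cycle_type g" using Suc(2) by (metis multiset_nonemptyE size_empty nat.distinct(1))
  have a2: "a \<ge> 2" by (rule is_cycle_typeD[OF is_cycle_type_cycle_type[OF Suc(3,5)] a])
  obtain y where y: "y \<in> A" "a = card (orbit g y)" using cycle_typeE[OF a Suc(3,5)] by blast
  obtain y' where y': "y' \<in> A'" "a = card (orbit g' y')"
    using cycle_typeE[OF a[unfolded Suc(8)] Suc(4,6)] by blast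
  obtain B h where B: "distinct B" "set B \<subseteq> A" "h permutes (A - set B)"
    "g = cycle_of_list B \<circ> h" "length B = a"
    using split_off_cycle[OF Suc(3,5) y(1)] unfolding y(2) by metis
  obtain B' h' where B': "distinct B'" "set B' \<subseteq> A'" "h' permutes (A' - set B')"
    "g' = cycle_of_list B' \<circ> h'" "length B' = a"
    using split_off_cycle[OF Suc(4,6) y'(1)] unfolding y'(2) by metis
  have type: "cycle_type g = add_mset a (cycle_type h)" "cycle_type g' = add_mset a (cycle_type h')"
    using cycle_type_cycle_comp[OF B(1,3)] cycle_type_cycle_comp[OF B'(1,3)] Suc(5,6) a2 B(5) B'(5)
    unfolding B(4) B'(4) by (auto simp: cycle_part_def)
  have "\<exists>p. bij_betw p (A - set B) (A' - set B') \<and> (\<forall>x\<in>A - set B. p (h x) = h' (p x))"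
  proof (rule Suc(1))
    show "k = size (cycle_type h)" using Suc(2) type by simp
    show "card (A - set B) = card (A' - set B')"
      using B B' Suc(5,6,7) by (simp add: card_Diff_subset distinct_card)
    show "cycle_type h = cycle_type h'" using type Suc(8) by simp
  qed (use B B' Suc(5,6) in auto)
  then obtain p where p: "bij_betw p (A - set B) (A' - set B')" "\<forall>x\<in>A - set B. p (h x) = h' (p x)"
    by blast
  define q where "q x = (if x \<in> set B then the (map_of (zip B B') x) else p x)" for x
  have q_nth: "q (B ! i) = B' ! i" if "i < a" for i
    using that B(1,5) B'(5) by (simp add: q_def map_of_zip_nth)
  have map_q: "map q B = B'" by (rule nth_equalityI) (use B B' q_nth in auto)
  have "bij_betw q (set B) (set B')"
  proof (rule bij_betw_imageI)
    show "q ` set B = set B'" using map_q by (metis set_map)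
    show "inj_on q (set B)" using B'(1) map_q by (metis distinct_map)
  qed
  moreover have "bij_betw q (A - set B) (A' - set B')"
    using p(1) by (rule bij_betw_cong[THEN iffD1, rotated]) (simp add: q_def)
  ultimately have "bij_betw q (set B \<union> (A - set B)) (set B' \<union> (A' - set B'))"
    by (rule bij_betw_combine) auto
  then have "bij_betw q A A'" using B(2) B'(2) by (simp add: Un_absorb1)
  moreover have "q (g x) = g' (q x)" if x: "x \<in> A" for x
  proof (cases "x \<in> set B")
    case True
    then obtain i where i: "i < a" "x = B ! i" using B(5) by (auto simp: in_set_conv_nth)
    have "h x = x" using permutes_not_in[OF B(3)] True by blast
    then have "g x = B ! (Suc i mod a)"
      using cycle_of_list_nth[OF B(1), of i 1] i B(5) by (simp add: B(4))
    then have "q (g x) = B' ! (Suc i mod a)" using q_nth a2 by simp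
    moreover have "q x = B' ! i" using i q_nth by simp
    moreover from this have "q x \<in> set B'" using i B'(5) by simp
    then have "h' (q x) = q x" using permutes_not_in[OF B'(3)] by blast
    then have "g' (q x) = B' ! (Suc i mod a)"
      using cycle_of_list_nth[OF B'(1), of i 1] i B'(5) \<open>q x = B' ! i\<close> by (simp add: B'(4))
    ultimately show ?thesis by simp
  next
    case False
    then have xB: "x \<in> A - set B" using x by blast
    then have "h x \<in> A - set B" using permutes_in_image[OF B(3)] by blast
    then have "g x = h x" "q (g x) = p (h x)" by (simp_all add: B(4) id_outside_supp q_def)
    moreover have "q x = p x" using False by (simp add: q_def)
    moreover have "p x \<in> A' - set B'" using bij_betwE[OF p(1)] xB by blast
    then have "h' (p x) \<in> A' - set B'" using permutes_in_image[OF B'(3)] by blast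
    then have "g' (p x) = h' (p x)" by (simp add: B'(4) id_outside_supp)
    ultimately show ?thesis using p(2) xB by simp
  qed
  ultimately show ?case by blast
qed

lemma ex_permutes_cycle_type:
  assumes "is_cycle_type \<mu>" "finite A" "sum_mset \<mu> \<le> card A"
  shows "\<exists>g. g permutes A \<and> cycle_type g = \<mu>"
  using assms
proof (induction \<mu> arbitrary: A)
  case empty
  have "id permutes A" "cycle_type id = {#}" by (auto simp: permutes_id cycle_type_def)
  then show ?case by blast
next
  case (add a \<mu>)
  then obtain S where S: "S \<subseteq> A" "card S = a" "finite S" using obtain_subset_with_card_n[of a A] by auto
  obtain B where B: "set B = S" "distinct B" using finite_distinct_list[OF S(3)] by blast
  have "sum_mset \<mu> \<le> card (A - S)" using add.prems S by (simp add: card_Diff_subset)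
  then obtain h where h: "h permutes (A - S)" "cycle_type h = \<mu>"
    using add.IH[of "A - S"] add.prems by auto
  have "(cycle_of_list B \<circ> h) permutes A"
    by (rule permutes_compose[OF permutes_subset[OF h(1)] permutes_subset[OF cycle_permutes]])
       (use B S in auto)
  moreover have "cycle_type (cycle_of_list B \<circ> h) = cycle_type h + cycle_part (length B)"
    by (rule cycle_type_cycle_comp[OF B(2) h(1)]) (use add.prems B in auto)
  then have "cycle_type (cycle_of_list B \<circ> h) = add_mset a \<mu>"
    using add.prems(1) B S h(2) distinct_card[OF B(2)] by (simp add: cycle_part_def)
  ultimately show ?case by blast
qed

section \<open>Irreducible characters of the symmetric group\<close>

lemma normalized_value_cycle_type:
  assumes \<chi>: "\<chi> \<in> Irr (sym_group n)" and g: "g permutes {1..n}"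
  shows "normalized_value n \<chi> (cycle_type g) = \<chi> g / \<chi> id"
proof -
  interpret group "sym_group n" by (rule sym_group_is_group)
  have const: "\<chi> g' = \<chi> g" if g': "g' permutes {1..n}" "cycle_type g' = cycle_type g" for g'
  proof -
    obtain p where p: "bij_betw p {1..n} {1..n}" "\<forall>x\<in>{1..n}. p (g x) = g' (p x)"
      using ex_conjugating_bij[OF g g'(1)] g'(2) by auto
    define P where "P x = (if x \<in> {1..n} then p x else x)" for x
    have "bij_betw P {1..n} {1..n}"
      using p(1) by (rule bij_betw_cong[THEN iffD1, rotated]) (simp add: P_def)
    then have P: "P permutes {1..n}" by (rule bij_imp_permutes) (simp only: P_def if_False)
    have "P (g x) = g' (P x)" for x
    proof (cases "x \<in> {1..n}")
      case True
      then have "g x \<in> {1..n}" using permutes_in_image[OF g] by blast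
      then show ?thesis using True p(2) by (simp add: P_def)
    next
      case False
      then show ?thesis
        using permutes_not_in[OF g False] permutes_not_in[OF g'(1) False]
        by (simp only: P_def if_False)
    qed
    then have "P \<circ> g = g' \<circ> P" by (simp add: fun_eq_iff)
    then have conj: "P \<circ> g \<circ> inv' P = g'"
      by (simp only: comp_assoc permutes_inv_o(1)[OF P] comp_id)
    have carrier: "g \<in> carrier (sym_group n)" "P \<in> carrier (sym_group n)"
      using g P by (simp_all add: sym_group_carrier)
    show ?thesis
      using Irr_conj[OF sym_group_is_group \<chi> carrier]
      unfolding sym_group_mult sym_group_inv_equality[OF carrier(2)] conj .
  qed
  have mem: "f \<in> cycle_class n (cycle_type g) \<longleftrightarrow>
      f permutes {1..n} \<and> cycle_type f = cycle_type g" for f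
    by (simp add: cycle_class_def sym_group_carrier)
  have "\<chi> ` cycle_class n (cycle_type g) = {\<chi> g}"
  proof (intro equalityI subsetI)
    fix v assume "v \<in> \<chi> ` cycle_class n (cycle_type g)"
    then obtain f where "f \<in> cycle_class n (cycle_type g)" "v = \<chi> f" by (rule imageE)
    then show "v \<in> {\<chi> g}" using const[of f] unfolding mem by simp
  next
    fix v assume "v \<in> {\<chi> g}"
    moreover have "g \<in> cycle_class n (cycle_type g)" unfolding mem using g by simp
    ultimately show "v \<in> \<chi> ` cycle_class n (cycle_type g)" by (simp add: rev_image_eqI)
  qed
  then show ?thesis by (simp add: normalized_value_def class_value_def sym_group_one)
qed

lemma cycle_of_list_snoc:
  "cycle_of_list (as @ [b, a]) = cycle_of_list (as @ [b]) \<circ> transpose a b"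
  by (induction as rule: cycle_of_list.induct) (auto simp: transpose_commute comp_assoc fun_eq_iff)

text \<open>Conjugation relabels the entries also when the list has repetitions, in which case
  \<open>cycle_of_list xs\<close> is only a product of transpositions.  This makes the family of words invariant.\<close>

lemma cycle_of_list_map:
  assumes "inj p"
  shows "p \<circ> cycle_of_list xs = cycle_of_list (map p xs) \<circ> p"
proof (induction xs rule: cycle_of_list.induct)
  case (1 i j xs)
  have "p \<circ> transpose i j = transpose (p i) (p j) \<circ> p"
    using assms by (auto simp: fun_eq_iff transpose_def inj_eq)
  then show ?case using 1 by (simp add: fun_eq_iff)
qed auto

lemma sum_lists_Suc:
  fixes f :: "'a list \<Rightarrow> 'b::comm_monoid_add"
  shows "(\<Sum>ys | set ys \<subseteq> A \<and> length ys = Suc j. f ys) =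
    (\<Sum>y\<in>A. \<Sum>ys | set ys \<subseteq> A \<and> length ys = j. f (y # ys))"
proof -
  let ?X = "{ys. set ys \<subseteq> A \<and> length ys = j}"
  have "(\<Sum>ys | set ys \<subseteq> A \<and> length ys = Suc j. f ys) = (\<Sum>(ys, y)\<in>?X \<times> A. f (y # ys))"
    unfolding lists_length_Suc_eq
    by (subst sum.reindex) (auto simp: inj_on_def case_prod_unfold)
  also have "\<dots> = (\<Sum>ys\<in>?X. \<Sum>y\<in>A. f (y # ys))" by (rule sum.cartesian_product[symmetric])
  also have "\<dots> = (\<Sum>y\<in>A. \<Sum>ys\<in>?X. f (y # ys))" by (rule sum.swap)
  finally show ?thesis .
qed

text \<open>A walk multiplies by transpositions on the left, while \<open>cycle_of_list\<close> puts its first transposition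
  outermost; hence the reversal of the word.\<close>

lemma walk_sum_conv_sum_lists:
  "walk_sum F n j y g =
    (\<Sum>ys | set ys \<subseteq> {1..n} \<and> length ys = j. F (cycle_of_list (rev (y # ys)) \<circ> g))"
proof (induction j arbitrary: y g)
  case 0
  have "{ys. set ys \<subseteq> {1..n} \<and> length ys = 0} = {[]}" by auto
  then show ?case by simp
next
  case (Suc j)
  show ?case
    unfolding walk_sum.simps Suc.IH sum_lists_Suc
    by (simp add: cycle_of_list_snoc comp_assoc)
qed

lemma sum_walk_sum:
  assumes g: "g permutes {1..n}"
  shows "(\<Sum>y\<in>{1..n}. walk_sum (\<lambda>g. r (cycle_type g)) n j y g) =
    (of_nat n - of_nat (sum_mset (cycle_type g))) * walk_value r n j 1 (cycle_type g)
    + (\<Sum>a\<in>#cycle_type g. of_nat a * walk_value r n j a (cycle_type g - {#a#}))"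
proof -
  let ?\<mu> = "cycle_type g"
  have point: "walk_sum (\<lambda>g. r (cycle_type g)) n j y g =
      walk_value r n j (card (orbit g y)) (?\<mu> - cycle_part (card (orbit g y)))"
    if y: "y \<in> {1..n}" for y
  proof -
    obtain B h where B: "distinct B" "B \<noteq> []" "hd B = y" "set B \<subseteq> {1..n}" "h permutes ({1..n} - set B)"
      "g = cycle_of_list B \<circ> h" "length B = card (orbit g y)"
      using split_off_cycle[OF g _ y] by blast
    have "?\<mu> = cycle_type h + cycle_part (length B)"
      unfolding B(6) by (rule cycle_type_cycle_comp[OF B(1,5)]) auto
    then have "?\<mu> - cycle_part (card (orbit g y)) = cycle_type h" by (simp add: B(7))
    then show ?thesis
      using walk_sum_eq_walk_value[OF B(1,2,4,5), of r j] unfolding B(3,7) B(6)[symmetric] by simp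
  qed
  have "(\<Sum>y\<in>{1..n}. walk_sum (\<lambda>g. r (cycle_type g)) n j y g) =
      (\<Sum>y\<in>{1..n}. walk_value r n j (card (orbit g y)) (?\<mu> - cycle_part (card (orbit g y))))"
    by (rule sum.cong) (auto simp only: point)
  also have "\<dots> = (of_nat (card {1..n}) - of_nat (sum_mset ?\<mu>)) * walk_value r n j 1 (?\<mu> - cycle_part 1)
      + (\<Sum>a\<in>#?\<mu>. of_nat a * walk_value r n j a (?\<mu> - cycle_part a))"
    by (rule sum_over_points_by_cycle[OF g]) simp
  also have "(\<Sum>a\<in>#?\<mu>. of_nat a * walk_value r n j a (?\<mu> - cycle_part a)) =
      (\<Sum>a\<in>#?\<mu>. of_nat a * walk_value r n j a (?\<mu> - {#a#}))"
    using is_cycle_typeD[OF is_cycle_type_cycle_type[OF g]]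
    by (intro arg_cong[of _ _ sum_mset] image_mset_cong) (auto simp: cycle_part_def)
  finally show ?thesis by (simp add: cycle_part_def)
qed

text \<open>Both sides are the sum over all words of the normalized character at the word times \<open>g\<close>: by
  centrality of the sum of all words on the left, and by following the walks from \<open>g\<close> on the right.\<close>

lemma admissible_normalized_value:
  assumes \<chi>: "\<chi> \<in> Irr (sym_group n)"
  shows "admissible n (normalized_value n \<chi>)"
  unfolding admissible_def
proof (intro conjI allI impI)
  interpret group "sym_group n" by (rule sym_group_is_group)
  let ?r = "normalized_value n \<chi>"
  have one: "\<chi> id \<noteq> 0"
    using Irr_one_nonzero[OF sym_group_is_group \<chi>] by (simp add: sym_group_one)
  note val = normalized_value_cycle_type[OF \<chi>]
  have id_type: "cycle_type id = {#}" by (simp add: cycle_type_def)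
  show "?r {#} = 1" using val[OF permutes_id] one by (simp add: id_type)
  fix \<mu> j assume \<mu>: "is_cycle_type \<mu> \<and> sum_mset \<mu> \<le> n"
  then obtain g where g: "g permutes {1..n}" "cycle_type g = \<mu>"
    using ex_permutes_cycle_type[of \<mu> "{1..n}"] by auto
  define I where "I = {ys. set ys \<subseteq> {1..n} \<and> length ys = Suc j}"
  define h where "h ys = cycle_of_list (rev ys)" for ys :: "nat list"
  have h: "h ys permutes {1..n}" if "ys \<in> I" for ys
    unfolding h_def using that by (intro permutes_subset[OF cycle_permutes]) (auto simp: I_def)
  have walk: "(\<Sum>y\<in>{1..n}. walk_sum (\<lambda>g. ?r (cycle_type g)) n j y f) = (\<Sum>ys\<in>I. \<chi> (h ys \<circ> f)) / \<chi> id"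
    if f: "f permutes {1..n}" for f
  proof -
    have "(\<Sum>y\<in>{1..n}. walk_sum (\<lambda>g. ?r (cycle_type g)) n j y f) =
        (\<Sum>ys\<in>I. ?r (cycle_type (h ys \<circ> f)))"
      unfolding walk_sum_conv_sum_lists I_def h_def sum_lists_Suc ..
    also have "\<dots> = (\<Sum>ys\<in>I. \<chi> (h ys \<circ> f) / \<chi> id)"
      by (rule sum.cong) (auto intro!: val permutes_compose f h)
    finally show ?thesis by (simp only: sum_divide_distrib)
  qed
  have "\<chi> \<one>\<^bsub>sym_group n\<^esub> * (\<Sum>ys\<in>I. \<chi> (h ys \<otimes>\<^bsub>sym_group n\<^esub> g)) = \<chi> g * (\<Sum>ys\<in>I. \<chi> (h ys))"
  proof (rule Irr_central_sum[OF sym_group_is_group \<chi>])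
    show "h ys \<in> carrier (sym_group n)" if "ys \<in> I" for ys
      using h[OF that] by (simp add: sym_group_carrier)
    show "g \<in> carrier (sym_group n)" using g by (simp add: sym_group_carrier)
    fix p assume "p \<in> carrier (sym_group n)"
    then have p: "p permutes {1..n}" by (simp add: sym_group_carrier)
    have map_I: "map f ` I \<subseteq> I" if f: "f permutes {1..n}" for f
    proof
      fix zs assume "zs \<in> map f ` I"
      then obtain ys where ys: "ys \<in> I" "zs = map f ys" by (rule imageE)
      then have "set zs \<subseteq> f ` {1..n}" unfolding I_def by (auto simp del: atLeastAtMost_iff)
      then show "zs \<in> I" using ys unfolding permutes_image[OF f] by (simp add: I_def)
    qed
    have "bij_betw (map p) I I"
    proof (rule bij_betw_byWitness[where f' = "map (inv' p)"])
      show "map p ` I \<subseteq> I" by (rule map_I[OF p])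
      show "map (inv' p) ` I \<subseteq> I" by (rule map_I[OF permutes_inv[OF p]])
    qed (auto simp: permutes_inverses[OF p] comp_def)
    moreover have "p \<otimes>\<^bsub>sym_group n\<^esub> h ys = h (map p ys) \<otimes>\<^bsub>sym_group n\<^esub> p" for ys
      using cycle_of_list_map[OF permutes_inj[OF p], of "rev ys"]
      by (simp add: sym_group_mult h_def rev_map)
    ultimately show "\<exists>\<pi>. bij_betw \<pi> I I \<and>
        (\<forall>i\<in>I. p \<otimes>\<^bsub>sym_group n\<^esub> h i = h (\<pi> i) \<otimes>\<^bsub>sym_group n\<^esub> p)"
      by blast
  qed
  then have central: "\<chi> id * (\<Sum>ys\<in>I. \<chi> (h ys \<circ> g)) = \<chi> g * (\<Sum>ys\<in>I. \<chi> (h ys \<circ> id))"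
    by (simp add: sym_group_one sym_group_mult)
  have "?r \<mu> * (of_nat n * walk_value ?r n j 1 {#}) = (\<chi> g / \<chi> id) * ((\<Sum>ys\<in>I. \<chi> (h ys \<circ> id)) / \<chi> id)"
    using sum_walk_sum[OF permutes_id, of ?r n j] walk[OF permutes_id] val[OF g(1)]
    by (simp add: id_type g(2))
  also have "\<dots> = (\<Sum>ys\<in>I. \<chi> (h ys \<circ> g)) / \<chi> id"
    using central one by (simp add: field_simps)
  also have "\<dots> = (of_nat n - of_nat (sum_mset \<mu>)) * walk_value ?r n j 1 \<mu>
      + (\<Sum>a\<in>#\<mu>. of_nat a * walk_value ?r n j a (\<mu> - {#a#}))"
    using sum_walk_sum[OF g(1), of ?r j] walk[OF g(1)] by (simp only: g(2))
  finally show "?r \<mu> * (of_nat n * walk_value ?r n j 1 {#}) =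
      (of_nat n - of_nat (sum_mset \<mu>)) * walk_value ?r n j 1 \<mu>
      + (\<Sum>a\<in>#\<mu>. of_nat a * walk_value ?r n j a (\<mu> - {#a#}))" .
qed

theorem corollary2p9:
  fixes C :: "nat \<Rightarrow> nat multiset" and L :: "nat multiset"
  assumes C_type: "\<And>k. k \<ge> 1 \<Longrightarrow> is_cycle_type (C k)"
    and C_norm: "\<And>k. k \<ge> 1 \<Longrightarrow> ct_norm (C k) = k"
    and L_type: "is_cycle_type L"
  shows "\<exists>T :: ratfun_mpoly.
           mpoly_vars T \<subseteq> {1..ct_norm L} \<and>
           (\<forall>n. occurs_in L n \<and> (\<forall>k\<in>{1..ct_norm L}. occurs_in (C k) n) \<longrightarrow>
              mpoly_regular_at T n \<and>
              (\<forall>\<chi>\<in>Irr (sym_group n).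
                 normalized_value n \<chi> L = mpoly_eval T n (\<lambda>k. normalized_value n \<chi> (C k))))"
proof -
  obtain f where f: "f \<in> poly_fun (ct_norm L)"
    and f_eq: "\<And>n r. admissible n r \<Longrightarrow> scaled_value L n r = f n (\<lambda>i. r (C i))"
    using scaled_value_expressible[OF C_type C_norm L_type] unfolding expressible_def by blast
  let ?q = "falling_poly (sum_mset L)"
  have "poly ?q (of_nat (sum_mset L)) \<noteq> 0" by (subst poly_falling_poly_eq_0_iff) simp
  then have "?q \<noteq> 0" by auto
  then obtain T where T: "mpoly_vars T \<subseteq> {1..ct_norm L}"
    "\<And>n t. poly ?q (of_nat n) \<noteq> 0 \<Longrightarrow>
      mpoly_regular_at T n \<and> mpoly_eval T n t = f n t / rat_poly_at ?q n"
    using poly_fun_divide_imp_mpoly[OF f] by blast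
  have "mpoly_regular_at T n \<and> (\<forall>\<chi>\<in>Irr (sym_group n).
      normalized_value n \<chi> L = mpoly_eval T n (\<lambda>k. normalized_value n \<chi> (C k)))"
    if "occurs_in L n" for n
  proof -
    have q: "poly ?q (of_nat n) \<noteq> 0"
      using that by (simp add: poly_falling_poly_eq_0_iff occurs_in_def)
    have "normalized_value n \<chi> L = mpoly_eval T n (\<lambda>k. normalized_value n \<chi> (C k))"
      if "\<chi> \<in> Irr (sym_group n)" for \<chi>
    proof -
      have "normalized_value n \<chi> L =
          f n (\<lambda>k. normalized_value n \<chi> (C k)) / rat_poly_at ?q n"
        using f_eq[OF admissible_normalized_value[OF that]] q
        by (simp add: scaled_value_def eq_divide_eq mult.commute)
      then show ?thesis using T(2)[OF q] by (simp only:)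
    qed
    then show ?thesis using T(2)[OF q] by blast
  qed
  then show ?thesis using T(1) by blast
qed

end
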